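(* Let $s$ be a composition, $\mathrm h$ an admissible height function for the DKK triangulation of $\mathcal F_{\mathcal O(s)}(\mathbf i)$, and for each Stirling $s$-permutation $w$ let $\mathbf v(w)\in\mathbb R^n$ be given by $\mathbf v(w)_a=\sum_{t=1}^{s_a}\big(\mathrm h(R[w_{[\ell(a^t)]}])-\mathrm h(R[w_{[\ell(a^t)+1]}])\big)$ (these are the vertices of $\mathrm{Perm}_s(\mathrm h)$). Let $1\le a<c\le n$ and let $w=u_1B_acu_2$ and $w'=u_1cB_au_2$ be Stirling $s$-permutations, where $B_a$ is the $a$-block. Then the edge of $\mathrm{Perm}_s(\mathrm h)$ corresponding to the transposition between $w$ and $w'$ satisfies $$\mathbf v(w')-\mathbf v(w)=\Big(\mathrm h(R[u_1c])+\mathrm h(R[u_1B_a])-\mathrm h(R[u_1])-\mathrm h(R[u_1B_ac])\Big)(\mathbf e_a-\mathbf e_c).$$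
   Context: $s=(s_1,\dots,s_n)$ positive integers, $s_{n+1}:=2$. Stirling $s$-permutation: rearrangement of $1^{s_1}\cdots n^{s_n}$ avoiding $121$; $w_{[i]}$ = prefix of length $i$; $\ell(a^t)$ = length of the prefix preceding the $t$-th occurrence of $a$; the $a$-block $B_a$ is the shortest factor containing all occurrences of $a$. Graph $\mathcal O(s)$: vertices $v_{-1},\dots,v_n$; source edges $e^i_1,\dots,e^i_{s_i-1}$ from $v_{-1}$ to $v_{n+1-i}$ ($i\in[n+1]$); bump $e^i_0$ and dip $e^i_{s_i}$ from $v_{n-i}$ to $v_{n+1-i}$ ($i\in[n]$); framing: incoming at $v_{n+1-i}$: $e^i_0\prec\cdots\prec e^i_{s_i}$; outgoing at $v_{n+1-i}$: $e^{i-1}_0\prec e^{i-1}_{s_{i-1}}$. Routes $R(k,t,\delta)$ have edges $e^k_t,e^{k-1}_{\delta_{k-1}s_{k-1}},\dots,e^1_{\delta_1s_1}$. Coherence: on each maximal common subpath $v_a\cdots v_b$ ($v_a\ne v_{-1}$, $v_b\neq v_n$), $P$ enters $v_a$ before $Q$ in the incoming order iff $P$ leaves $v_b$ before $Q$ in the outgoing order. The DKK triangulation of $\mathcal F_{\mathcal O(s)}(\mathbf i)=\mathrm{conv}\{\mathbf 1_R\}$ consists of $\mathrm{conv}\{\mathbf 1_R: R\in C\}$, $C$ pairwise coherent; $\mathrm h$ is admissible if lifting $\mathbf 1_R$ to height $\mathrm h(R)$ and projecting lower faces yields it. For a prefix $u$: $t_a$ = number of $a$'s in $u$; $c'$ least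 $b\in[n]$ with $0<t_b<s_b$ (else $c'=n+1,t_{n+1}=1$); $R[u]:=R(c',t_{c'},(t_1/s_1,\dots,t_{c'-1}/s_{c'-1}))$. $\mathrm{Perm}_s(\mathrm h)$ is the complex of bounded cells of the arrangement in $\mathbb R^n$ of the tropical hypersurfaces of $F^k_t(\mathbf x)=\min_{\delta\in\{0,1\}^{k-1}}(\mathrm h(R(k,t,\delta))+\sum_{i<k}\delta_ix_i)$, $k\in[2,n+1]$, $t\in[s_k-1]$. *)

theory Defs
  imports
    "HOL-Analysis.Analysis"
    "HOL-Analysis.Finite_Function_Topology"
    "HOL-Library.Sublist"
begin

(* Points of R^n and of R^(edges) are finitely supported functions, so that n may
   depend on the composition s = (s_1,...,s_n), which is a list.  Letters, parts and
   coordinates are numbered from 1. *)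

definition composition :: "nat list \<Rightarrow> bool" where
  "composition s \<longleftrightarrow> (\<forall>p\<in>set s. 0 < p)"

(* s_i for 1 <= i <= n+1, with the convention s_(n+1) = 2 *)
definition part :: "nat list \<Rightarrow> nat \<Rightarrow> nat" where
  "part s i = (s @ [2]) ! (i - 1)"

definition stirling_perm :: "nat list \<Rightarrow> nat list \<Rightarrow> bool" where
  "stirling_perm s w \<longleftrightarrow>
     (\<forall>a. count_list w a = (if a \<in> {1..length s} then part s a else 0)) \<and>
     \<not> (\<exists>i j k. i < j \<and> j < k \<and> k < length w \<and> w ! i = w ! k \<and> w ! i < w ! j)"

definition is_block :: "nat list \<Rightarrow> nat \<Rightarrow> nat list \<Rightarrow> bool" where
  "is_block w a B \<longleftrightarrow>
     is_arg_min length (\<lambda>B. sublist B w \<and> count_list B a = count_list w a) B"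

(* length of the prefix of w that precedes the t-th occurrence (t = 1, 2, ...) of a *)
definition occ :: "nat list \<Rightarrow> nat \<Rightarrow> nat \<Rightarrow> nat" where
  "occ w a t = filter (\<lambda>i. w ! i = a) [0..<length w] ! (t - 1)"


section \<open>The framed graph O(s)\<close>

(* The edge e^i_t is the pair (i, t); the vertex v_j is the integer j. *)
type_synonym edge = "nat \<times> nat"

definition edges :: "nat list \<Rightarrow> edge set" where
  "edges s = {(i, t). i \<in> {1..length s + 1} \<and> t \<in> {1..part s i - 1}}
           \<union> {(i, t). i \<in> {1..length s} \<and> t \<in> {0, part s i}}"

fun edge_tail :: "nat list \<Rightarrow> edge \<Rightarrow> int" where
  "edge_tail s (i, t) =
     (if t \<in> {1..part s i - 1} then - 1 else int (length s) - int i)"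

fun edge_head :: "nat list \<Rightarrow> edge \<Rightarrow> int" where
  "edge_head s (i, t) = int (length s) + 1 - int i"

(* The framing.  Two edges with the same head have the same superscript, and so do two
   edges with the same tail other than v_(-1), so comparing subscripts is enough. *)
definition in_before :: "nat list \<Rightarrow> edge \<Rightarrow> edge \<Rightarrow> bool" where
  "in_before s e f \<longleftrightarrow> edge_head s e = edge_head s f \<and> snd e < snd f"

definition out_before :: "nat list \<Rightarrow> edge \<Rightarrow> edge \<Rightarrow> bool" where
  "out_before s e f \<longleftrightarrow> edge_tail s e = edge_tail s f \<and> snd e < snd f"

definition routes :: "nat list \<Rightarrow> edge list set" where
  "routes s = {P. P \<noteq> [] \<and> set P \<subseteq> edges s \<and>
     successively (\<lambda>e f. edge_head s e = edge_tail s f) P \<and>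
     edge_tail s (hd P) = - 1 \<and> edge_head s (last P) = int (length s)}"

(* M is a maximal common subpath; it starts at the common head of p and q, ends at the
   common tail of p' and q', and may consist of a single vertex (M = []). *)
definition coherent :: "nat list \<Rightarrow> edge list \<Rightarrow> edge list \<Rightarrow> bool" where
  "coherent s P Q \<longleftrightarrow>
     (\<forall>P1 P2 Q1 Q2 M p p' q q'.
        P = P1 @ [p] @ M @ [p'] @ P2 \<longrightarrow> Q = Q1 @ [q] @ M @ [q'] @ Q2 \<longrightarrow>
        edge_head s p = edge_head s q \<longrightarrow> p \<noteq> q \<longrightarrow> p' \<noteq> q' \<longrightarrow>
        (in_before s p q \<longleftrightarrow> out_before s p' q'))"

definition route :: "nat list \<Rightarrow> nat \<Rightarrow> nat \<Rightarrow> (nat \<Rightarrow> nat) \<Rightarrow> edge list" where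
  "route s k t \<delta> = (k, t) # map (\<lambda>i. (i, \<delta> i * part s i)) (rev [1..<k])"


section \<open>The DKK triangulation and admissible heights\<close>

definition indicator_vec :: "edge list \<Rightarrow> edge \<Rightarrow>\<^sub>0 real" where
  "indicator_vec P = (\<Sum>e\<in>set P. Poly_Mapping.single e 1)"

definition dkk_triangulation :: "nat list \<Rightarrow> (edge \<Rightarrow>\<^sub>0 real) set set" where
  "dkk_triangulation s =
     {convex hull (indicator_vec ` C) | C.
        C \<noteq> {} \<and> C \<subseteq> routes s \<and> pairwise (coherent s) C}"

definition lifted_polytope ::
    "nat list \<Rightarrow> (edge list \<Rightarrow> real) \<Rightarrow> ((edge \<Rightarrow>\<^sub>0 real) \<times> real) set" where
  "lifted_polytope s h = convex hull ((\<lambda>P. (indicator_vec P, h P)) ` routes s)"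

(* a face exposed by a functional whose height coefficient is positive (normalised to 1) *)
definition lower_face :: "('a::real_vector \<times> real) set \<Rightarrow> ('a \<times> real) set \<Rightarrow> bool" where
  "lower_face S F \<longleftrightarrow>
     (\<exists>\<phi>. linear \<phi> \<and> F = {p \<in> S. \<forall>q\<in>S. \<phi> (fst p) + snd p \<le> \<phi> (fst q) + snd q})"

definition admissible :: "nat list \<Rightarrow> (edge list \<Rightarrow> real) \<Rightarrow> bool" where
  "admissible s h \<longleftrightarrow>
     {fst ` F | F. lower_face (lifted_polytope s h) F} = dkk_triangulation s"


section \<open>The complex Perm_s(h)\<close>

definition euclidean :: "nat \<Rightarrow> (nat \<Rightarrow>\<^sub>0 real) set" where
  "euclidean n = {x. Poly_Mapping.keys x \<subseteq> {1..n}}"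

definition exponents :: "nat \<Rightarrow> (nat \<Rightarrow> nat) set" where
  "exponents k = (\<Pi>\<^sub>E i\<in>{1..<k}. {0, 1})"

definition trop_term :: "nat list \<Rightarrow> (edge list \<Rightarrow> real) \<Rightarrow> nat \<Rightarrow> nat \<Rightarrow>
    (nat \<Rightarrow>\<^sub>0 real) \<Rightarrow> (nat \<Rightarrow> nat) \<Rightarrow> real" where
  "trop_term s h k t x \<delta> =
     h (route s k t \<delta>) + (\<Sum>i\<in>{1..<k}. real (\<delta> i) * Poly_Mapping.lookup x i)"

definition trop_poly :: "nat list \<Rightarrow> (edge list \<Rightarrow> real) \<Rightarrow> nat \<Rightarrow> nat \<Rightarrow>
    (nat \<Rightarrow>\<^sub>0 real) \<Rightarrow> real" where
  "trop_poly s h k t x = Min (trop_term s h k t x ` exponents k)"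

definition minimizers :: "nat list \<Rightarrow> (edge list \<Rightarrow> real) \<Rightarrow> nat \<Rightarrow> nat \<Rightarrow>
    (nat \<Rightarrow>\<^sub>0 real) \<Rightarrow> (nat \<Rightarrow> nat) set" where
  "minimizers s h k t x = {\<delta> \<in> exponents k. trop_term s h k t x \<delta> = trop_poly s h k t x}"

definition trop_hypersurface :: "nat list \<Rightarrow> (edge list \<Rightarrow> real) \<Rightarrow> nat \<Rightarrow> nat \<Rightarrow>
    (nat \<Rightarrow>\<^sub>0 real) set" where
  "trop_hypersurface s h k t = {x \<in> euclidean (length s). 2 \<le> card (minimizers s h k t x)}"

definition hypersurface_indices :: "nat list \<Rightarrow> (nat \<times> nat) set" where
  "hypersurface_indices s = (SIGMA k:{2..length s + 1}. {1..part s k - 1})"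

(* The closed cell of the arrangement whose relative interior contains x: cells are
   described, as usual, by which terms attain the minimum in each tropical polynomial. *)
definition arrangement_cell :: "nat list \<Rightarrow> (edge list \<Rightarrow> real) \<Rightarrow>
    (nat \<Rightarrow>\<^sub>0 real) \<Rightarrow> (nat \<Rightarrow>\<^sub>0 real) set" where
  "arrangement_cell s h x = {y \<in> euclidean (length s).
     \<forall>(k, t)\<in>hypersurface_indices s. minimizers s h k t x \<subseteq> minimizers s h k t y}"

(* Each hypersurface of the arrangement is a union of cells. *)
lemma trop_hypersurface_Union_cells:
  assumes "(k, t) \<in> hypersurface_indices s"
  shows "trop_hypersurface s h k t = (\<Union>x\<in>trop_hypersurface s h k t. arrangement_cell s h x)"
proof -
  have "finite (minimizers s h k t y)" for y
    by (simp add: minimizers_def exponents_def finite_PiE)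
  then have "2 \<le> card (minimizers s h k t y)"
    if "2 \<le> card (minimizers s h k t x)" "minimizers s h k t x \<subseteq> minimizers s h k t y" for x y
    using that by (meson card_mono le_trans)
  with assms show ?thesis
    unfolding trop_hypersurface_def arrangement_cell_def by fastforce
qed

definition Perm :: "nat list \<Rightarrow> (edge list \<Rightarrow> real) \<Rightarrow> (nat \<Rightarrow>\<^sub>0 real) set set" where
  "Perm s h = {C \<in> arrangement_cell s h ` euclidean (length s). bounded C}"

definition Perm_vertex :: "nat list \<Rightarrow> (edge list \<Rightarrow> real) \<Rightarrow> (nat \<Rightarrow>\<^sub>0 real) \<Rightarrow> bool" where
  "Perm_vertex s h x \<longleftrightarrow> {x} \<in> Perm s h"

(* the segment from x to y is a one-dimensional cell with end points x and y *)
definition Perm_edge :: "nat list \<Rightarrow> (edge list \<Rightarrow> real) \<Rightarrow>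
    (nat \<Rightarrow>\<^sub>0 real) \<Rightarrow> (nat \<Rightarrow>\<^sub>0 real) \<Rightarrow> bool" where
  "Perm_edge s h x y \<longleftrightarrow>
     Perm_vertex s h x \<and> Perm_vertex s h y \<and> x \<noteq> y \<and> closed_segment x y \<in> Perm s h"


section \<open>Routes of prefixes and the points v(w)\<close>

definition active_letter :: "nat list \<Rightarrow> nat list \<Rightarrow> nat" where
  "active_letter s u =
     (if \<exists>b\<in>{1..length s}. 0 < count_list u b \<and> count_list u b < part s b
      then LEAST b. b \<in> {1..length s} \<and> 0 < count_list u b \<and> count_list u b < part s b
      else length s + 1)"

(* R[u]; for a prefix u, the quotients t_i / s_i with i < c' are exact (0 or 1). *)
definition prefix_route :: "nat list \<Rightarrow> nat list \<Rightarrow> edge list" where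
  "prefix_route s u =
     (let c = active_letter s u
      in route s c (if c = length s + 1 then 1 else count_list u c)
               (\<lambda>i. count_list u i div part s i))"

definition vert :: "nat list \<Rightarrow> (edge list \<Rightarrow> real) \<Rightarrow> nat list \<Rightarrow> nat \<Rightarrow>\<^sub>0 real" where
  "vert s h w =
     (\<Sum>a\<in>{1..length s}. Poly_Mapping.single a
        (\<Sum>t\<in>{1..part s a}. h (prefix_route s (take (occ w a t) w))
                             - h (prefix_route s (take (occ w a t + 1) w))))"

end

theory Submission
  imports Defs
begin

text \<open>
  By admissibility, the routes of the prefixes of a Stirling permutation, being pairwise coherent,
  are exactly the minimisers of \<open>h\<close> plus a linear functional on the edge space.  Only the
  differences of that functional between the bump and the dip at each vertex matter for the tropical
  polynomials, and they telescope to the coordinates of \<open>vert s h w\<close>.  Hence a term attains the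
  minimum at \<open>vert s h w\<close> iff its route belongs to a prefix of \<open>w\<close>.  Conversely the values of the
  tropical polynomials at a point \<open>y\<close> give such a functional, so the same telescoping recovers \<open>y\<close>
  from its slacks: it is \<open>vert s h w\<close> if all prefix routes of \<open>w\<close> have slack 0.

  The prefix routes of \<open>w\<close> and \<open>w'\<close> differ only in \<open>R[u1 B]\<close> and \<open>R[u1 c]\<close>.  A point where the
  common routes have slack 0 therefore differs from the two vertices by the slacks of these two
  routes times \<open>e\<^sub>a - e\<^sub>c\<close>; the slacks being nonnegative, it lies on the segment between them.
\<close>

section \<open>Prefixes of Stirling permutations and their routes\<close>

definition partial :: "nat list \<Rightarrow> nat list \<Rightarrow> nat \<Rightarrow> bool" where
  "partial s u b \<longleftrightarrow> b \<in> {1..length s} \<and> 0 < count_list u b \<and> count_list u b < part s b"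

definition bounded_counts :: "nat list \<Rightarrow> nat list \<Rightarrow> bool" where
  "bounded_counts s u \<longleftrightarrow> (\<forall>b\<in>{1..length s}. count_list u b \<le> part s b)"

text \<open>Subscript of the edge with superscript \<open>i\<close> in \<open>R[u]\<close>. The
  value 1 at \<open>length s + 1\<close> is the convention t_(n+1) = 1, so that the topmost source
  edge fits the same pattern.\<close>

definition level :: "nat list \<Rightarrow> nat list \<Rightarrow> nat \<Rightarrow> nat" where
  "level s u i = (if i = length s + 1 then 1 else count_list u i)"

lemma part_pos:
  assumes "composition s" "i \<in> {1..length s + 1}"
  shows "0 < part s i"
proof (cases "i = length s + 1")
  case True
  then show ?thesis by (simp add: part_def)
next
  case False
  with assms have "i - 1 < length s" by auto
  then have "part s i = s ! (i - 1)" by (simp add: part_def nth_append)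
  with \<open>i - 1 < length s\<close> assms show ?thesis by (simp add: composition_def)
qed

lemma part_last [simp]: "part s (Suc (length s)) = 2"
  by (simp add: part_def)

lemma active_letter_eq:
  "active_letter s u = (if \<exists>b. partial s u b then LEAST b. partial s u b else length s + 1)"
  unfolding active_letter_def partial_def by (simp add: Bex_def)

lemma active_letter_partial:
  assumes "partial s u b"
  shows "partial s u (active_letter s u)" "active_letter s u \<le> b"
proof -
  have eq: "active_letter s u = (LEAST b. partial s u b)"
    using assms by (auto simp: active_letter_eq)
  show "partial s u (active_letter s u)" unfolding eq by (rule LeastI) fact
  show "active_letter s u \<le> b" unfolding eq by (rule Least_le) fact
qed

lemma active_letter_none:
  assumes "\<And>b. \<not> partial s u b"
  shows "active_letter s u = length s + 1"
  using assms by (simp add: active_letter_eq)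

lemma active_letter_cases:
  obtains "partial s u (active_letter s u)" | "active_letter s u = length s + 1"
  using active_letter_partial active_letter_none by metis

lemma active_letter_range: "active_letter s u \<in> {1..length s + 1}"
  by (rule active_letter_cases[of s u]) (auto simp: partial_def)

lemma not_partial_below_active: "b < active_letter s u \<Longrightarrow> \<not> partial s u b"
  using active_letter_partial(2) by (meson not_less)

lemma active_letter_eqI:
  assumes "partial s u k" "\<And>b. b < k \<Longrightarrow> \<not> partial s u b"
  shows "active_letter s u = k"
  using active_letter_partial[OF assms(1)] assms(2) by (meson le_neq_implies_less)

lemma active_letter_cong:
  assumes "\<And>b. partial s u b \<longleftrightarrow> partial s v b"
  shows "active_letter s u = active_letter s v"
  by (metis active_letter_eqI active_letter_none active_letter_partial assms not_partial_below_active)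

lemma level_active:
  "level s u (active_letter s u) \<in> {1..part s (active_letter s u) - 1}"
  by (rule active_letter_cases[of s u]) (auto simp: level_def partial_def)

lemma level_below_active:
  assumes "composition s" "bounded_counts s u" "1 \<le> i" "i < active_letter s u"
  shows "level s u i \<in> {0, part s i}"
    and "count_list u i div part s i * part s i = level s u i"
    and "count_list u i div part s i \<in> {0, 1}"
proof -
  have i: "i \<in> {1..length s}"
    using assms active_letter_range[of s u] by auto
  have p: "0 < part s i" using part_pos[OF assms(1)] i by auto
  have "count_list u i = 0 \<or> count_list u i = part s i"
    using not_partial_below_active[OF assms(4)] assms(2) i by (force simp: partial_def bounded_counts_def)
  then show "level s u i \<in> {0, part s i}"
     "count_list u i div part s i * part s i = level s u i"
     "count_list u i div part s i \<in> {0, 1}" using i p by (auto simp: level_def)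
qed

lemma route_cong:
  assumes "\<And>i. 1 \<le> i \<Longrightarrow> i < k \<Longrightarrow> \<delta> i = \<delta>' i"
  shows "route s k t \<delta> = route s k t \<delta>'"
  using assms by (simp add: route_def)

lemma prefix_route_eq_route:
  "prefix_route s u = route s (active_letter s u) (level s u (active_letter s u))
     (\<lambda>i. count_list u i div part s i)"
  by (simp add: prefix_route_def level_def Let_def)

text \<open>This uniform form, in which the source edge looks like all others, is the basis for
  comparing routes, for their coherence and for their weights.\<close>

lemma prefix_route_eq_map:
  assumes "composition s" "bounded_counts s u"
  shows "prefix_route s u = map (\<lambda>i. (i, level s u i)) (rev [1..<Suc (active_letter s u)])"
proof -
  have "1 \<le> active_letter s u" using active_letter_range[of s u] by simp
  moreover have "map (\<lambda>i. (i, count_list u i div part s i * part s i)) (rev [1..<active_letter s u]) =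
     map (\<lambda>i. (i, level s u i)) (rev [1..<active_letter s u])"
    using level_below_active(2)[OF assms] by (intro map_cong) auto
  ultimately show ?thesis
    unfolding prefix_route_eq_route route_def by (simp add: upt_Suc)
qed

lemma prefix_route_eqI:
  assumes "composition s" "bounded_counts s u" "bounded_counts s v"
    and "active_letter s u = active_letter s v"
    and "\<And>i. 1 \<le> i \<Longrightarrow> i \<le> active_letter s u \<Longrightarrow> i \<le> length s \<Longrightarrow> count_list u i = count_list v i"
  shows "prefix_route s u = prefix_route s v"
proof -
  have "level s u i = level s v i" if "i \<in> {1..active_letter s u}" for i
    using that assms(5)[of i] active_letter_range[of s u] by (auto simp: level_def)
  then show ?thesis
    using assms(4) by (auto simp: prefix_route_eq_map[OF assms(1,2)] prefix_route_eq_map[OF assms(1,3)])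
qed

text \<open>A partially used letter \<open>k\<close> bounds the active letter from above, so counts
  of letters above \<open>k\<close> never enter the route.\<close>

lemma prefix_route_eqI_partial:
  assumes "composition s" "bounded_counts s u" "bounded_counts s v" "partial s u k"
    and "\<And>i. i \<le> k \<Longrightarrow> count_list u i = count_list v i"
  shows "prefix_route s u = prefix_route s v"
proof (rule prefix_route_eqI[OF assms(1-3)])
  have le: "active_letter s u \<le> k" using active_letter_partial[OF assms(4)] by simp
  have eq: "partial s v b \<longleftrightarrow> partial s u b" if "b \<le> k" for b
    using assms(5)[OF that] by (simp add: partial_def)
  show "active_letter s u = active_letter s v"
  proof (rule active_letter_eqI[symmetric])
    show "partial s v (active_letter s u)"
      using eq le active_letter_partial(1)[OF assms(4)] by blast
    show "\<not> partial s v b" if "b < active_letter s u" for b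
      using eq le that not_partial_below_active by auto
  qed
  show "count_list u i = count_list v i" if "i \<le> active_letter s u" for i
    using assms(5) that le by simp
qed

lemma prefix_route_count_cong:
  assumes "\<And>b. count_list u b = count_list v b"
  shows "prefix_route s u = prefix_route s v"
proof -
  have "count_list u = count_list v" using assms by blast
  then show ?thesis by (simp only: prefix_route_def active_letter_def)
qed

lemma prefix_route_eqD:
  assumes "composition s" "bounded_counts s u" "bounded_counts s v"
    and "prefix_route s u = prefix_route s v"
  shows "active_letter s u = active_letter s v"
    and "\<And>i. 1 \<le> i \<Longrightarrow> i \<le> active_letter s u \<Longrightarrow> i \<le> length s \<Longrightarrow> count_list u i = count_list v i"
proof -
  note e = assms(4)[unfolded prefix_route_eq_map[OF assms(1,2)] prefix_route_eq_map[OF assms(1,3)]]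
  from arg_cong[OF e, of length]
  show act: "active_letter s u = active_letter s v"
    by (simp del: upt_Suc)
  show "count_list u i = count_list v i"
    if "1 \<le> i" "i \<le> active_letter s u" "i \<le> length s" for i
  proof -
    have "level s u i = level s v i"
      using e that unfolding act by (simp del: upt_Suc)
    then show ?thesis using that by (simp add: level_def)
  qed
qed

lemma stirling_count:
  "stirling_perm s w \<Longrightarrow> b \<in> {1..length s} \<Longrightarrow> count_list w b = part s b"
  by (simp add: stirling_perm_def)

lemma stirling_set: "stirling_perm s w \<Longrightarrow> b \<in> set w \<Longrightarrow> b \<in> {1..length s}"
  by (metis count_list_0_iff stirling_perm_def)

lemma bounded_counts_prefix:
  assumes "stirling_perm s (u @ v)"
  shows "bounded_counts s u"
  using stirling_count[OF assms] by (fastforce simp: bounded_counts_def)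

lemma stirling_no_121:
  assumes "stirling_perm s (u @ [x] @ v)" "b < x" "b \<in> set u"
  shows "b \<notin> set v"
proof
  assume "b \<in> set v"
  then obtain k where k: "k < length v" "v ! k = b" by (auto simp: in_set_conv_nth)
  obtain i where i: "i < length u" "u ! i = b" using assms(3) by (auto simp: in_set_conv_nth)
  let ?w = "u @ [x] @ v"
  have "?w ! i = b" "?w ! (length u) = x" "?w ! (length u + 1 + k) = b"
    using k i by (auto simp: nth_append)
  moreover have "i < length u" "length u < length u + 1 + k" "length u + 1 + k < length ?w"
    using k i by auto
  ultimately show False using assms(1,2) unfolding stirling_perm_def by metis
qed

text \<open>A letter \<open>b < x\<close> that is partially used when \<open>x\<close> comes next
  would occur on both sides of \<open>x\<close>, which is the forbidden pattern 121.\<close>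

lemma stirling_not_partial:
  assumes "stirling_perm s (u @ [x] @ v)" "b < x"
  shows "\<not> partial s u b" "\<not> partial s (u @ [x]) b"
proof -
  show *: "\<not> partial s u b"
  proof
    assume p: "partial s u b"
    then have "count_list (u @ [x] @ v) b = part s b"
      using stirling_count[OF assms(1)] by (simp add: partial_def)
    with p assms(2) have "0 < count_list v b" by (auto simp: partial_def)
    then have "b \<in> set v" by (metis count_list_0_iff not_less0)
    moreover have "b \<in> set u" using p by (metis count_list_0_iff not_less0 partial_def)
    ultimately show False using stirling_no_121[OF assms] by blast
  qed
  then show "\<not> partial s (u @ [x]) b" using assms(2) by (simp add: partial_def)
qed

lemma active_ge_next_letter:
  assumes "stirling_perm s (u @ [x] @ v)"
  shows "x \<le> active_letter s u" "x \<le> active_letter s (u @ [x])"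
proof -
  have x: "x \<le> length s" using stirling_set[OF assms, of x] by auto
  show "x \<le> active_letter s u"
    using x stirling_not_partial(1)[OF assms] by (metis active_letter_cases le_SucI Suc_eq_plus1 leI)
  show "x \<le> active_letter s (u @ [x])"
    using x stirling_not_partial(2)[OF assms] by (metis active_letter_cases le_SucI Suc_eq_plus1 leI)
qed

section \<open>Cutting words at occurrences, factors and blocks\<close>

lemma split_at_occurrence:
  assumes "t < count_list w a"
  obtains u v where "w = u @ [a] @ v" "count_list u a = t"
  using assms
proof (induction w arbitrary: thesis rule: rev_induct)
  case (snoc x w)
  show ?case
  proof (cases "t < count_list w a")
    case True
    then obtain u v where "w = u @ [a] @ v" "count_list u a = t" using snoc.IH by blast
    then show ?thesis using snoc.prems(1)[of u "v @ [x]"] by simp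
  next
    case False
    with snoc.prems(2) have "x = a" "count_list w a = t" by (auto split: if_splits)
    then show ?thesis using snoc.prems(1)[of w "[]"] by simp
  qed
qed simp

lemma occ_append:
  "occ (u @ [a] @ v) a (Suc (count_list u a)) = length u"
proof -
  let ?w = "u @ [a] @ v" and ?P = "\<lambda>i. (u @ [a] @ v) ! i = a"
  have "filter ?P [0..<length u] = filter (\<lambda>i. u ! i = a) [0..<length u]"
    by (intro filter_cong) (auto simp: nth_append)
  moreover have "length (filter (\<lambda>i. u ! i = a) [0..<length u]) = count_list u a"
    unfolding count_list_eq_length_filter length_filter_conv_card
    by (auto simp: distinct_length_filter intro!: arg_cong[where f = card])
  moreover have "[0..<length ?w] = [0..<length u] @ [length u] @ [Suc (length u)..<length ?w]"
    using upt_add_eq_append[of 0 "length u" "Suc (length v)"] by (simp add: upt_conv_Cons del: upt_Suc)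
  ultimately show ?thesis
    by (simp add: occ_def nth_append del: upt_Suc)
qed

text \<open>Cases by the place of the cut. Both pieces of \<open>B\<close> are nonempty in the
  middle case, so cuts at the ends of \<open>B\<close> go to the outer cases.\<close>

lemma prefix_split_append:
  assumes "p @ q = u @ B @ v"
  obtains p' where "u = p @ p'" | B1 B2 where "B1 \<noteq> []" "B2 \<noteq> []" "B = B1 @ B2" "p = u @ B1" "q = B2 @ v"
    | p' where "p = u @ B @ p'" "v = p' @ q"
proof -
  consider r where "u = p @ r" | r where "p = u @ r" "r @ q = B @ v" "r \<noteq> []"
    using assms by (metis append_eq_append_conv2 append_Nil2)
  then show ?thesis
  proof cases
    case 1 then show ?thesis using that(1) by blast
  next
    case 2
    from 2(2) consider r' where "B = r @ r'" "q = r' @ v" "r' \<noteq> []" | r' where "r = B @ r'" "v = r' @ q"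
      by (metis append_eq_append_conv2 append_Nil append_Nil2)
    then show ?thesis using that(2,3) 2 by cases auto
  qed
qed

text \<open>An outer letter different from \<open>a\<close> could be dropped, leaving a shorter
  factor with all occurrences of \<open>a\<close>.\<close>

lemma is_block_ends:
  assumes "is_block w a B" "a \<in> set w"
  shows "B \<noteq> []" "hd B = a" "last B = a"
proof -
  have sub: "sublist B w" "count_list B a = count_list w a"
    and least: "\<And>B'. sublist B' w \<Longrightarrow> count_list B' a = count_list w a \<Longrightarrow> length B \<le> length B'"
    using assms(1) by (fastforce simp: is_block_def is_arg_min_def not_less)+
  have "count_list B a \<noteq> 0" using assms(2) sub(2) by (simp add: count_list_0_iff)
  then show ne: "B \<noteq> []" by auto
  show "hd B = a"
  proof (rule ccontr)
    assume n: "hd B \<noteq> a"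
    from ne obtain x B' where B: "B = x # B'" by (cases B) auto
    have "sublist B' w" using sub(1) unfolding B by (metis sublist_Cons_right sublist_order.dual_order.trans sublist_order.order.refl)
    moreover have "count_list B' a = count_list w a" using n sub(2) B by simp
    ultimately show False using least B by fastforce
  qed
  show "last B = a"
  proof (rule ccontr)
    assume n: "last B \<noteq> a"
    from ne obtain x B' where B: "B = B' @ [x]" by (cases B rule: rev_cases) auto
    have "sublist B' w" using sub(1) unfolding B by (metis sublist_append_rightI sublist_order.dual_order.trans)
    moreover have "count_list B' a = count_list w a" using n sub(2) B by simp
    ultimately show False using least B by fastforce
  qed
qed

section \<open>Linear functionals exposing a coherent set of routes\<close>

text \<open>Value at \<open>indicator_vec P\<close> of the linear functional that takes the values
  \<psi> on the unit vectors.\<close>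

definition weight :: "(edge \<Rightarrow> real) \<Rightarrow> edge list \<Rightarrow> real" where
  "weight \<psi> P = sum \<psi> (set P)"

lemma weight_route:
  "weight \<psi> (route s k t \<delta>) = \<psi> (k, t) + (\<Sum>i\<in>{1..<k}. \<psi> (i, \<delta> i * part s i))"
proof -
  have "inj_on (\<lambda>i. (i, \<delta> i * part s i)) {1..<k}" by (auto simp: inj_on_def)
  moreover have "(k, t) \<notin> (\<lambda>i. (i, \<delta> i * part s i)) ` {1..<k}" by auto
  ultimately show ?thesis by (simp add: weight_def route_def sum.reindex)
qed

lemma weight_prefix_route:
  assumes "composition s" "bounded_counts s u"
  shows "weight \<psi> (prefix_route s u) = (\<Sum>i\<in>{1..active_letter s u}. \<psi> (i, level s u i))"
proof -
  have "inj_on (\<lambda>i. (i, level s u i)) {1..active_letter s u}" by (auto simp: inj_on_def)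
  then show ?thesis
    by (simp add: weight_def prefix_route_eq_map[OF assms] sum.reindex atLeastLessThanSuc_atLeastAtMost
        del: upt_Suc)
qed

section \<open>Classification of the routes of O(s)\<close>

lemma route_in_routes:
  assumes "composition s" "k \<in> {1..length s + 1}" "t \<in> {1..part s k - 1}"
    and "\<And>i. 1 \<le> i \<Longrightarrow> i < k \<Longrightarrow> \<delta> i \<in> {0, 1}"
  shows "route s k t \<delta> \<in> routes s"
proof -
  let ?g = "\<lambda>i. (i, \<delta> i * part s i)"
  have edge: "?g i \<in> edges s" "edge_tail s (?g i) = int (length s) - int i" if "1 \<le> i" "i < k" for i
    using assms(2) assms(4)[OF that] that by (auto simp: edges_def)
  \<comment> \<open>The first edge \<open>(j, x)\<close> is arbitrary, because the induction
    hypothesis is applied to the next edge, whose subscript is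
    \<open>\<delta> j * part s j\<close>.\<close>
  have path: "successively (\<lambda>e f. edge_head s e = edge_tail s f) ((j, x) # map ?g (rev [1..<j])) \<and>
      edge_head s (last ((j, x) # map ?g (rev [1..<j]))) = int (length s)"
    if "1 \<le> j" "j \<le> k" for j x
    using that
  proof (induction j arbitrary: x rule: nat_induct_at_least)
    case base
    then show ?case by simp
  next
    case (Suc j)
    then have "rev [1..<Suc j] = j # rev [1..<j]" by simp
    moreover have "edge_head s (Suc j, x) = edge_tail s (?g j)"
      using edge(2)[of j] Suc by simp
    ultimately show ?case
      using Suc.IH[of "\<delta> j * part s j"] Suc.prems by (simp del: edge_tail.simps)
  qed
  have "(k, t) \<in> edges s" "edge_tail s (k, t) = - 1" using assms(2,3) by (auto simp: edges_def)
  with edge(1) path[of k t] assms(2) show ?thesis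
    by (auto simp: routes_def route_def simp del: edge_tail.simps edge_head.simps)
qed

text \<open>The start of the path is left free, so that induction can remove edges from the
  front.\<close>

lemma path_to_sink_eq:
  assumes "composition s" "P \<noteq> []" "set P \<subseteq> edges s"
    and "successively (\<lambda>e f. edge_head s e = edge_tail s f) P"
    and "edge_head s (last P) = int (length s)"
  shows "\<exists>\<delta>. (\<forall>i. \<delta> i \<in> {0, 1}) \<and> P = route s (fst (hd P)) (snd (hd P)) \<delta>"
  using assms(2-)
proof (induction P)
  case (Cons e P)
  show ?case
  proof (cases P)
    case Nil
    obtain k t where e: "e = (k, t)" by force
    with Cons.prems Nil have "k = 1" by auto
    then show ?thesis using Nil e by (intro exI[of _ "\<lambda>_. 0"]) (simp add: route_def)
  next
    case (Cons f Q)
    obtain k t where e: "e = (k, t)" by force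
    obtain j x where f: "f = (j, x)" by force
    obtain \<delta> where \<delta>: "\<forall>i. \<delta> i \<in> {0, 1}" "P = route s j x \<delta>"
      using Cons.IH Cons.prems Cons f by auto
    have head: "int (length s) + 1 - int k = edge_tail s (j, x)"
      using Cons.prems Cons e f by simp
    \<comment> \<open>The head of \<open>e\<close> has a nonnegative index, so the next edge does
      not leave v_(-1): it is a bump or a dip with superscript one lower.\<close>
    have "k \<in> {1..length s + 1}" using Cons.prems e by (auto simp: edges_def)
    with head have "\<not> x \<in> {1..part s j - 1}" "k = Suc j" by (auto split: if_splits)
    moreover have "(j, x) \<in> edges s" using Cons.prems Cons f by simp
    ultimately have x: "j \<in> {1..length s}" "x \<in> {0, part s j}" by (auto simp: edges_def)
    define \<delta>' where "\<delta>' = \<delta>(j := if x = 0 then 0 else 1)"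
    have "\<delta>' j * part s j = x" using x by (auto simp: \<delta>'_def)
    then have "e # P = route s k t \<delta>'"
      using x(1) \<delta>(2) \<open>k = Suc j\<close> e by (auto simp: route_def \<delta>'_def)
    moreover have "\<forall>i. \<delta>' i \<in> {0, 1}" using \<delta>(1) by (simp add: \<delta>'_def)
    ultimately show ?thesis unfolding e list.sel fst_conv snd_conv by blast
  qed
qed simp

lemma routes_eq:
  assumes "composition s" "P \<in> routes s"
  obtains k t \<delta> where "k \<in> {1..length s + 1}" "t \<in> {1..part s k - 1}" "\<delta> \<in> exponents k"
    "P = route s k t \<delta>"
proof -
  from assms(2) have P: "P \<noteq> []" "set P \<subseteq> edges s"
    "successively (\<lambda>e f. edge_head s e = edge_tail s f) P"
    "edge_head s (last P) = int (length s)" "edge_tail s (hd P) = - 1"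
    by (auto simp: routes_def)
  obtain k t where kt: "hd P = (k, t)" by force
  obtain \<delta> where \<delta>: "\<forall>i. \<delta> i \<in> {0, 1}" "P = route s k t \<delta>"
    using path_to_sink_eq[OF assms(1) P(1-4)] kt by auto
  have "(k, t) \<in> edges s" using P(1,2) kt by (metis hd_in_set subsetD)
  with P(5) kt have "k \<in> {1..length s + 1}" "t \<in> {1..part s k - 1}"
    by (auto simp: edges_def split: if_splits)
  moreover have "P = route s k t (restrict \<delta> {1..<k})"
    unfolding \<delta>(2) by (rule route_cong) simp
  moreover have "restrict \<delta> {1..<k} \<in> exponents k"
    using \<delta>(1) by (auto simp: exponents_def)
  ultimately show ?thesis using that by blast
qed

lemma exponents_mem: "\<delta> \<in> exponents k \<Longrightarrow> 1 \<le> i \<Longrightarrow> i < k \<Longrightarrow> \<delta> i \<in> {0, 1}"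
  by (auto simp: exponents_def)

text \<open>The source edge of \<open>R\<close> is recognised by its subscript strictly between 0
  and \<open>part s k\<close>, so it is also the source edge of \<open>P\<close>; below it each
  route has exactly one edge per superscript.\<close>

lemma routes_antichain:
  assumes "composition s" "P \<in> routes s" "R \<in> routes s" "set R \<subseteq> set P"
  shows "R = P"
proof -
  obtain k t \<delta> where R: "k \<in> {1..length s + 1}" "t \<in> {1..part s k - 1}" "R = route s k t \<delta>"
    using routes_eq[OF assms(1,3)] .
  obtain k' t' \<delta>' where P: "\<delta>' \<in> exponents k'" "P = route s k' t' \<delta>'"
    using routes_eq[OF assms(1,2)] .
  have "(k, t) \<in> set P" using assms(4) R(3) by (auto simp: route_def)
  then have kt: "k = k'" "t = t'"
    using exponents_mem[OF P(1), of k] R(2) unfolding P(2) by (auto simp: route_def)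
  have "\<delta> i * part s i = \<delta>' i * part s i" if "i \<in> {1..<k}" for i
  proof -
    have "(i, \<delta> i * part s i) \<in> set P" using assms(4) that by (auto simp: R(3) route_def)
    then show ?thesis using that kt by (auto simp: P(2) route_def)
  qed
  then show ?thesis using kt unfolding R(3) P(2) route_def by simp
qed

section \<open>From lower faces of the lifted polytope to sets of routes\<close>

lemma lookup_scaleR [simp]:
  "Poly_Mapping.lookup (r *\<^sub>R x) i = r *\<^sub>R Poly_Mapping.lookup x i"
proof -
  have "finite {i. r *\<^sub>R Poly_Mapping.lookup x i \<noteq> 0}"
    by (rule finite_subset[OF _ finite_lookup[of x]]) auto
  then show ?thesis by (simp add: scaleR_poly_mapping_def)
qed

lemma lookup_indicator_vec:
  "Poly_Mapping.lookup (indicator_vec P) e = (if e \<in> set P then 1 else 0)"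
  by (simp add: indicator_vec_def lookup_sum lookup_single when_def)

lemma linear_indicator_vec:
  assumes "linear \<phi>"
  shows "\<phi> (indicator_vec P) = weight (\<lambda>e. \<phi> (Poly_Mapping.single e 1)) P"
  by (simp add: indicator_vec_def weight_def linear_sum[OF assms])

lemma convex_insert_open_halfspace:
  fixes l :: "'a::real_vector \<Rightarrow> real"
  assumes "linear l" "l p = c"
  shows "convex (insert p {x. l x < c})"
proof (rule convexI)
  fix x y and u v :: real
  assume x: "x \<in> insert p {x. l x < c}" and y: "y \<in> insert p {x. l x < c}"
    and uv: "0 \<le> u" "0 \<le> v" "u + v = 1"
  have l: "l (u *\<^sub>R x + v *\<^sub>R y) = u * l x + v * l y"
    using assms(1) by (simp add: linear_add linear_scale)
  have le: "l x \<le> c" "l y \<le> c" using x y assms(2) by auto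
  have c: "u * c + v * c = c" using uv(3) by (metis distrib_right mult_1)
  consider "u = 0" | "v = 0" | "x = p" "y = p" | "u > 0" "l x < c" | "v > 0" "l y < c"
    using x y uv by fastforce
  then show "u *\<^sub>R x + v *\<^sub>R y \<in> insert p {x. l x < c}"
  proof cases
    case 3
    then show ?thesis using uv(3) by (simp flip: scaleR_add_left)
  next
    case 4
    then have "u * l x < u * c" "v * l y \<le> v * c" using le uv by (auto intro: mult_left_mono)
    then show ?thesis using l c by simp
  next
    case 5
    then have "u * l x \<le> u * c" "v * l y < v * c" using le uv by (auto intro: mult_left_mono)
    then show ?thesis using l c by simp
  qed (use x y uv in auto)
qed

lemma linear_sum_lookup:
  "linear (\<lambda>x. \<Sum>e\<in>A. Poly_Mapping.lookup x e :: real)"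
  by (rule linearI) (simp_all add: lookup_add sum.distrib sum_distrib_left)

text \<open>By \<open>routes_antichain\<close>, counting the edges in \<open>set R\<close> is a
  linear functional whose maximum over the routes is attained at \<open>R\<close> alone; so
  indicator vectors are vertices.\<close>

lemma sum_lookup_indicator_vec_less:
  assumes "composition s" "P \<in> routes s" "R \<in> routes s" "P \<noteq> R"
  shows "(\<Sum>e\<in>set R. Poly_Mapping.lookup (indicator_vec P) e) < real (card (set R))"
proof -
  obtain e where e: "e \<in> set R" "e \<notin> set P" using routes_antichain[OF assms(1-3)] assms(4) by blast
  have "(\<Sum>e\<in>set R. Poly_Mapping.lookup (indicator_vec P) e) < (\<Sum>e\<in>set R. 1)"
    using e by (intro sum_strict_mono_ex1) (auto simp: lookup_indicator_vec)
  then show ?thesis by simp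
qed

lemma sum_lookup_indicator_vec_self:
  "(\<Sum>e\<in>set R. Poly_Mapping.lookup (indicator_vec R) e) = real (card (set R))"
  by (simp add: lookup_indicator_vec)

text \<open>Over a vertex of the flow polytope lies a single point of the lifted polytope: all other
  generators project into an open half-space that has this vertex on its boundary.\<close>

lemma lifted_polytope_height:
  assumes "composition s" "R \<in> routes s" "(indicator_vec R, y) \<in> lifted_polytope s h"
  shows "y = h R"
proof -
  define l where "l = (\<lambda>x. \<Sum>e\<in>set R. Poly_Mapping.lookup x e :: real)"
  let ?c = "real (card (set R))" and ?p = "(indicator_vec R, h R)"
  have lR: "l (indicator_vec R) = ?c" by (simp add: l_def sum_lookup_indicator_vec_self)
  have less: "l (indicator_vec P) < ?c" if "P \<in> routes s" "P \<noteq> R" for P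
    using sum_lookup_indicator_vec_less[OF assms(1) that(1) assms(2) that(2)] by (simp add: l_def)
  have "linear (l \<circ> fst)" unfolding l_def by (intro linear_compose linear_fst linear_sum_lookup)
  then have "convex (insert ?p {x. (l \<circ> fst) x < ?c})"
    by (rule convex_insert_open_halfspace) (simp add: lR)
  moreover have "(\<lambda>P. (indicator_vec P, h P)) ` routes s \<subseteq> insert ?p {x. (l \<circ> fst) x < ?c}"
  proof (rule image_subsetI)
    fix P assume "P \<in> routes s"
    then show "(indicator_vec P, h P) \<in> insert ?p {x. (l \<circ> fst) x < ?c}"
      using less[of P] by (cases "P = R") auto
  qed
  ultimately have "lifted_polytope s h \<subseteq> insert ?p {x. (l \<circ> fst) x < ?c}"
    unfolding lifted_polytope_def by (intro hull_minimal)
  with assms(3) lR show ?thesis by auto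
qed

lemma indicator_vec_in_hull:
  assumes "composition s" "R \<in> routes s" "C \<subseteq> routes s"
    and "indicator_vec R \<in> convex hull (indicator_vec ` C)"
  shows "R \<in> C"
proof (rule ccontr)
  assume "R \<notin> C"
  define l where "l = (\<lambda>x. \<Sum>e\<in>set R. Poly_Mapping.lookup x e :: real)"
  let ?c = "real (card (set R))"
  have "convex {x. l x < ?c}"
  proof -
    have "{x. l x < ?c} = l -` {..<?c}" by auto
    then show ?thesis
      using linear_sum_lookup by (auto simp: l_def intro: convex_linear_vimage)
  qed
  moreover have "indicator_vec ` C \<subseteq> {x. l x < ?c}"
    using sum_lookup_indicator_vec_less[OF assms(1) _ assms(2)] assms(3) \<open>R \<notin> C\<close> by (auto simp: l_def)
  ultimately have "convex hull (indicator_vec ` C) \<subseteq> {x. l x < ?c}" by (intro hull_minimal)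
  with assms(4) show False by (auto simp: l_def sum_lookup_indicator_vec_self)
qed

text \<open>Admissibility only equates sets of polytopes. As indicator vectors are vertices, the
  routes in the hull of \<open>C\<close> are those of \<open>C\<close>, and a face projecting onto
  this hull contains precisely their lifted points.\<close>

lemma admissible_potential:
  assumes "composition s" "admissible s h"
    and "C \<noteq> {}" "C \<subseteq> routes s" "pairwise (coherent s) C"
  obtains \<psi> m where "\<And>R. R \<in> routes s \<Longrightarrow> m \<le> h R + weight \<psi> R"
    and "\<And>R. R \<in> routes s \<Longrightarrow> h R + weight \<psi> R = m \<longleftrightarrow> R \<in> C"
proof -
  let ?S = "lifted_polytope s h"
  have "convex hull (indicator_vec ` C) \<in> dkk_triangulation s"
    using assms(3-5) by (auto simp: dkk_triangulation_def)
  then have "convex hull (indicator_vec ` C) \<in> {fst ` F | F. lower_face ?S F}"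
    using assms(2) by (simp only: admissible_def)
  then obtain F where F: "lower_face ?S F" "fst ` F = convex hull (indicator_vec ` C)"
    by blast
  from F(1) obtain \<phi> where \<phi>: "linear \<phi>"
    "F = {p \<in> ?S. \<forall>q\<in>?S. \<phi> (fst p) + snd p \<le> \<phi> (fst q) + snd q}"
    by (auto simp: lower_face_def)
  define \<psi> where "\<psi> = (\<lambda>e. \<phi> (Poly_Mapping.single e 1))"
  have w: "\<phi> (indicator_vec R) = weight \<psi> R" for R
    unfolding \<psi>_def by (rule linear_indicator_vec[OF \<phi>(1)])
  have S: "(indicator_vec R, h R) \<in> ?S" if "R \<in> routes s" for R
    unfolding lifted_polytope_def using that by (intro hull_inc) auto
  have F_iff: "(indicator_vec R, h R) \<in> F \<longleftrightarrow> R \<in> C" if "R \<in> routes s" for R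
  proof
    assume "(indicator_vec R, h R) \<in> F"
    then have "indicator_vec R \<in> convex hull (indicator_vec ` C)"
      unfolding F(2)[symmetric] by (metis fst_conv imageI)
    then show "R \<in> C" using indicator_vec_in_hull[OF assms(1) that assms(4)] by blast
  next
    assume "R \<in> C"
    then have "indicator_vec R \<in> fst ` F" unfolding F(2) by (intro hull_inc) auto
    then obtain y where y: "(indicator_vec R, y) \<in> F" by auto
    \<comment> \<open>The face is only known to contain some point over
      \<open>indicator_vec R\<close>; uniqueness of the height identifies it with the lifted
      route.\<close>
    moreover have "y = h R" using y \<phi>(2) lifted_polytope_height[OF assms(1) that] by auto
    ultimately show "(indicator_vec R, h R) \<in> F" by simp
  qed
  obtain R0 where R0: "R0 \<in> C" using assms(3) by blast
  define m where "m = h R0 + weight \<psi> R0"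
  have R0F: "(indicator_vec R0, h R0) \<in> F" using F_iff R0 assms(4) by blast
  have le: "m \<le> h R + weight \<psi> R" if "R \<in> routes s" for R
    using R0F S[OF that] unfolding \<phi>(2) m_def w[symmetric] by fastforce
  have "h R + weight \<psi> R = m \<longleftrightarrow> R \<in> C" if R: "R \<in> routes s" for R
  proof -
    have "(indicator_vec R, h R) \<in> F \<longleftrightarrow> h R + weight \<psi> R = m"
    proof
      assume "(indicator_vec R, h R) \<in> F"
      then have "h R + weight \<psi> R \<le> m"
        using S[of R0] R0 assms(4) unfolding \<phi>(2) m_def w[symmetric] by fastforce
      with le[OF R] show "h R + weight \<psi> R = m" by simp
    next
      assume "h R + weight \<psi> R = m"
      then show "(indicator_vec R, h R) \<in> F"
        using R0F S[OF R] unfolding \<phi>(2) m_def w[symmetric] by (simp add: add.commute)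
    qed
    with F_iff[OF R] show ?thesis by simp
  qed
  with le that show ?thesis by blast
qed

section \<open>The clique of a Stirling permutation\<close>

text \<open>The clique of the triangulation attached to \<open>w\<close>. The empty prefix and
  \<open>w\<close> itself are included and contribute the routes through only bumps and only
  dips.\<close>

definition prefix_routes :: "nat list \<Rightarrow> nat list \<Rightarrow> edge list set" where
  "prefix_routes s w = prefix_route s ` {u. prefix u w}"

lemma prefix_routesI: "w = u @ v \<Longrightarrow> prefix_route s u \<in> prefix_routes s w"
  by (auto simp: prefix_routes_def)

lemma prefix_routesE:
  assumes "R \<in> prefix_routes s w"
  obtains u v where "w = u @ v" "R = prefix_route s u"
  using assms by (auto simp: prefix_routes_def prefix_def)

lemma prefix_route_in_routes:
  assumes "composition s" "bounded_counts s u"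
  shows "prefix_route s u \<in> routes s"
  unfolding prefix_route_eq_route
  using level_active level_below_active(3)[OF assms] active_letter_range
  by (intro route_in_routes[OF assms(1)]) auto

lemma prefix_routes_subset:
  assumes "composition s" "stirling_perm s w"
  shows "prefix_routes s w \<subseteq> routes s"
  using prefix_route_in_routes[OF assms(1)] bounded_counts_prefix assms(2)
  by (auto elim!: prefix_routesE)

text \<open>The entry at index \<open>i\<close> of the descending list is \<open>f (k - i)\<close>,
  so the lengths of the pieces determine the edges on either side of \<open>M\<close>.\<close>

lemma split_descending_map:
  assumes "map f (rev [1..<Suc k]) = P1 @ [p] @ M @ [p'] @ P2"
  shows "length P1 + length M + 1 < k" "p = f (k - length P1)" "p' = f (k - length P1 - length M - 1)"
proof -
  note e = assms
  have nth: "map f (rev [1..<Suc k]) ! i = f (k - i)" if "i < k" for i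
    using that by (simp add: rev_nth Suc_diff_Suc del: upt_Suc)
  show l: "length P1 + length M + 1 < k"
    using arg_cong[OF e, of length] by (simp del: upt_Suc)
  show "p = f (k - length P1)"
    using nth[of "length P1"] l unfolding e by (simp add: nth_append)
  have "(P1 @ [p] @ M @ [p'] @ P2) ! (length P1 + length M + 1) = p'"
    by (simp add: nth_append)
  then show "p' = f (k - length P1 - length M - 1)"
    using nth[of "length P1 + length M + 1"] l unfolding e by simp
qed

text \<open>The framing compares subscripts, which are letter counts. If one prefix has counts at
  most those of the other, its differing edges come first both on entering and on leaving a common
  subpath.\<close>

lemma coherent_prefix_route:
  assumes "composition s" "bounded_counts s u" "bounded_counts s v"
    and mono: "(\<forall>b. count_list u b \<le> count_list v b) \<or> (\<forall>b. count_list v b \<le> count_list u b)"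
  shows "coherent s (prefix_route s u) (prefix_route s v)"
  unfolding coherent_def
proof (intro allI impI)
  fix P1 P2 Q1 Q2 M and p p' q q' :: edge
  assume P: "prefix_route s u = P1 @ [p] @ M @ [p'] @ P2"
    and Q: "prefix_route s v = Q1 @ [q] @ M @ [q'] @ Q2"
    and ne: "p \<noteq> q" "p' \<noteq> q'" and head: "edge_head s p = edge_head s q"
  note P' = split_descending_map[OF P[unfolded prefix_route_eq_map[OF assms(1,2)]]]
  note Q' = split_descending_map[OF Q[unfolded prefix_route_eq_map[OF assms(1,3)]]]
  define j where "j = active_letter s u - length P1"
  define i where "i = j - length M - 1"
  \<comment> \<open>The common head forces equal superscripts, and the common \<open>M\<close> then
    makes the superscripts of \<open>p'\<close> and \<open>q'\<close> agree as well.\<close>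
  have j: "active_letter s v - length Q1 = j" using head P'(2) Q'(2) by (simp add: j_def)
  have p: "p = (j, level s u j)" "p' = (i, level s u i)" using P' by (simp_all add: i_def j_def)
  have q: "q = (j, level s v j)" "q' = (i, level s v i)" using Q' j by (simp_all add: i_def)
  have i: "1 \<le> i" "i < active_letter s u" "i < active_letter s v"
    using P'(1) Q'(1) j by (auto simp: i_def j_def)
  \<comment> \<open>Edges after the first are bumps or dips, so \<open>p'\<close> and
    \<open>q'\<close> leave the same vertex.\<close>
  have "level s u i \<in> {0, part s i}" "level s v i \<in> {0, part s i}"
    using level_below_active(1)[OF assms(1)] assms(2,3) i by blast+
  then have tail: "edge_tail s p' = edge_tail s q'" unfolding p q by auto
  have "(\<forall>b. level s u b \<le> level s v b) \<or> (\<forall>b. level s v b \<le> level s u b)"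
    using mono by (auto simp: level_def)
  then show "in_before s p q \<longleftrightarrow> out_before s p' q'"
    using ne head tail unfolding in_before_def out_before_def p q
    by (metis nat_less_le not_less snd_conv)
qed

lemma prefix_routes_coherent:
  assumes "composition s" "stirling_perm s w"
  shows "pairwise (coherent s) (prefix_routes s w)"
proof (rule pairwiseI)
  fix P Q assume "P \<in> prefix_routes s w" "Q \<in> prefix_routes s w"
  then obtain u u' v v' where u: "w = u @ u'" "P = prefix_route s u" and v: "w = v @ v'" "Q = prefix_route s v"
    by (metis prefix_routesE)
  have "prefix u v \<or> prefix v u"
    using u(1) v(1) by (metis prefixI prefix_same_cases)
  then have "(\<forall>b. count_list u b \<le> count_list v b) \<or> (\<forall>b. count_list v b \<le> count_list u b)"
    by (auto simp: prefix_def)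
  moreover have "bounded_counts s u" "bounded_counts s v"
    using assms(2) u(1) v(1) by (metis bounded_counts_prefix)+
  ultimately show "coherent s P Q"
    unfolding u(2) v(2) by (intro coherent_prefix_route[OF assms(1)])
qed

lemma prefix_route_exponents:
  assumes "composition s" "bounded_counts s u"
  obtains \<delta> where "\<delta> \<in> exponents (active_letter s u)"
    "prefix_route s u = route s (active_letter s u) (level s u (active_letter s u)) \<delta>"
proof
  let ?\<delta> = "restrict (\<lambda>i. count_list u i div part s i) {1..<active_letter s u}"
  show "?\<delta> \<in> exponents (active_letter s u)"
    unfolding exponents_def using level_below_active(3)[OF assms]
    by (auto simp: restrict_def PiE_def extensional_def Pi_def)
  show "prefix_route s u = route s (active_letter s u) (level s u (active_letter s u)) ?\<delta>"
    unfolding prefix_route_eq_route by (rule route_cong) simp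
qed

text \<open>The prefix ending with the \<open>t\<close>-th occurrence of \<open>k\<close> has source
  edge \<open>(k, t)\<close>; for the top superscript the empty prefix serves. Thus the clique meets
  every tropical polynomial.\<close>

lemma prefix_of_type:
  assumes "composition s" "stirling_perm s w" "k \<in> {1..length s + 1}" "t \<in> {1..part s k - 1}"
  obtains u v where "w = u @ v" "active_letter s u = k" "level s u k = t"
proof (cases "k = length s + 1")
  case True
  have "active_letter s [] = k" unfolding True by (rule active_letter_none) (simp add: partial_def)
  moreover have "level s [] k = t" using True assms(4) by (simp add: level_def)
  ultimately show ?thesis using that[of "[]" w] by simp
next
  case False
  then have k: "k \<in> {1..length s}" using assms(3) by auto
  then have "t - 1 < count_list w k" using stirling_count[OF assms(2)] assms(4) by auto
  then obtain u v where w: "w = u @ [k] @ v" "count_list u k = t - 1" by (rule split_at_occurrence)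
  have t: "count_list (u @ [k]) k = t" using w(2) assms(4) by simp
  have "active_letter s (u @ [k]) = k"
  proof (rule active_letter_eqI)
    show "partial s (u @ [k]) k" using t k assms(4) by (auto simp: partial_def)
    show "\<not> partial s (u @ [k]) b" if "b < k" for b
      using stirling_not_partial(2)[of s u k v b] assms(2) that w(1) by simp
  qed
  moreover have "level s (u @ [k]) k = t" using t False by (simp add: level_def)
  ultimately show ?thesis using that[of "u @ [k]" v] w(1) by simp
qed

section \<open>Coordinates of v(w) from edge potentials\<close>

lemma lookup_vert:
  assumes "b \<in> {1..length s}"
  shows "Poly_Mapping.lookup (vert s g w) b =
    (\<Sum>t\<in>{1..part s b}. g (prefix_route s (take (occ w b t) w))
                        - g (prefix_route s (take (occ w b t + 1) w)))"
  using assms by (simp add: vert_def lookup_sum lookup_single when_def)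

lemma vert_in_euclidean: "vert s g w \<in> euclidean (length s)"
proof -
  have "Poly_Mapping.lookup (vert s g w) b = 0" if "b \<notin> {1..length s}" for b
    using that by (auto simp: vert_def lookup_sum lookup_single when_def intro!: sum.neutral)
  then show ?thesis unfolding euclidean_def in_keys_iff subset_iff by blast
qed

lemma euclidean_eqI:
  assumes "x \<in> euclidean n" "y \<in> euclidean n"
    and "\<And>b. b \<in> {1..n} \<Longrightarrow> Poly_Mapping.lookup x b = Poly_Mapping.lookup y b"
  shows "x = y"
proof (rule poly_mapping_eqI)
  fix b
  show "Poly_Mapping.lookup x b = Poly_Mapping.lookup y b"
  proof (cases "b \<in> {1..n}")
    case False
    then have "b \<notin> Poly_Mapping.keys x" "b \<notin> Poly_Mapping.keys y"
      using assms(1,2) by (auto simp: euclidean_def)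
    then show ?thesis by (simp add: in_keys_iff)
  qed (rule assms(3))
qed

text \<open>A prefix without partially used letters below \<open>a\<close> has a route whose part above \<open>a\<close> depends
  only on the letters above \<open>a\<close>.\<close>

definition weight_above :: "nat list \<Rightarrow> (edge \<Rightarrow> real) \<Rightarrow> nat \<Rightarrow> nat list \<Rightarrow> real" where
  "weight_above s \<psi> a u = (\<Sum>i\<in>{a<..active_letter s u}. \<psi> (i, level s u i))"

text \<open>If \<open>a\<close> is partially used, the route starts at level \<open>a\<close>.
  Otherwise deleting the letters up to \<open>a\<close> changes neither the partially used letters
  nor the active letter.\<close>

lemma weight_prefix_route_split:
  assumes "composition s" "bounded_counts s u" "a \<in> {1..length s}"
    and "\<And>b. b < a \<Longrightarrow> \<not> partial s u b"
  shows "weight \<psi> (prefix_route s u) = (\<Sum>i\<in>{1..<a}. \<psi> (i, count_list u i)) + \<psi> (a, count_list u a) +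
    (if partial s u a then 0 else weight_above s \<psi> a (filter ((<) a) u))"
proof -
  let ?k = "active_letter s u" and ?v = "filter ((<) a) u"
  have below: "(\<Sum>i\<in>{1..a}. \<psi> (i, level s u i)) = (\<Sum>i\<in>{1..<a}. \<psi> (i, count_list u i)) + \<psi> (a, count_list u a)"
  proof -
    have "{1..a} = insert a {1..<a}" using assms(3) by auto
    moreover have "level s u i = count_list u i" if "i \<in> {1..a}" for i
      using that assms(3) by (simp add: level_def)
    ultimately show ?thesis using assms(3) by (simp add: add.commute)
  qed
  show ?thesis
  proof (cases "partial s u a")
    case True
    then have "?k = a" using assms(4) active_letter_eqI by blast
    then show ?thesis using True below weight_prefix_route[OF assms(1,2)] by simp
  next
    case False
    have up: "count_list ?v b = (if a < b then count_list u b else 0)" for b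
      by (induction u) auto
    have "partial s ?v b \<longleftrightarrow> partial s u b" for b
      using False assms(4)[of b] up[of b] by (cases b a rule: linorder_cases) (auto simp: partial_def)
    then have act: "active_letter s ?v = ?k" by (rule active_letter_cong)
    have "a \<le> ?k"
      using assms(3,4) active_letter_cases[of s u] by (metis atLeastAtMost_iff leI le_SucI Suc_eq_plus1)
    then have "{1..?k} = {1..a} \<union> {a<..?k}" using assms(3) by auto
    then have "weight \<psi> (prefix_route s u) =
        (\<Sum>i\<in>{1..a}. \<psi> (i, level s u i)) + (\<Sum>i\<in>{a<..?k}. \<psi> (i, level s u i))"
      unfolding weight_prefix_route[OF assms(1,2)] by (simp only:) (rule sum.union_disjoint, auto)
    also have "(\<Sum>i\<in>{a<..?k}. \<psi> (i, level s u i)) = weight_above s \<psi> a ?v"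
      unfolding weight_above_def act by (intro sum.cong) (auto simp: level_def up)
    finally show ?thesis using False below by simp
  qed
qed

text \<open>No larger letter lies between two occurrences of \<open>a\<close>, so the letters above
  \<open>a\<close> seen before any occurrence are those seen before the first one.\<close>

lemma stirling_filter_greater:
  assumes "stirling_perm s (u @ [a] @ v)"
  shows "filter ((<) a) u = filter ((<) a) (takeWhile (\<lambda>x. x \<noteq> a) (u @ [a] @ v))"
proof (cases "a \<in> set u")
  case False
  then have "takeWhile (\<lambda>x. x \<noteq> a) (u @ [a] @ v) = u"
    by (subst takeWhile_append2) auto
  then show ?thesis by simp
next
  case True
  then obtain y z where u: "u = y @ [a] @ z" "a \<notin> set y"
    by (metis append_Cons append_Nil split_list_first)
  have "\<not> a < x" if "x \<in> set z" for x
  proof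
    assume "a < x"
    from that obtain z1 z2 where "z = z1 @ [x] @ z2" by (metis append_Cons append_Nil split_list)
    then have "stirling_perm s ((y @ [a] @ z1) @ [x] @ (z2 @ [a] @ v))" using assms u(1) by simp
    from stirling_no_121[OF this \<open>a < x\<close>] show False by simp
  qed
  then have "filter ((<) a) z = []" by (auto simp: filter_empty_conv)
  moreover have "takeWhile (\<lambda>x. x \<noteq> a) (u @ [a] @ v) = y"
  proof -
    have "takeWhile (\<lambda>x. x \<noteq> a) (y @ [a] @ z @ [a] @ v) = y @ takeWhile (\<lambda>x. x \<noteq> a) ([a] @ z @ [a] @ v)"
      using u(2) by (intro takeWhile_append2) auto
    then show ?thesis using u(1) by simp
  qed
  ultimately show ?thesis using u(1) by simp
qed

text \<open>On the clique \<open>g\<close> is minus the weight up to a constant, and along the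
  occurrences of \<open>a\<close> the differences of weights telescope. The function
  \<open>g\<close> is arbitrary because both \<open>h\<close> and minus a weight are inserted
  later.\<close>

lemma lookup_vert_potential:
  assumes "composition s" "stirling_perm s w" "a \<in> {1..length s}"
    and "\<And>R. R \<in> prefix_routes s w \<Longrightarrow> g R + weight \<psi> R = m"
  shows "Poly_Mapping.lookup (vert s g w) a = \<psi> (a, part s a) - \<psi> (a, 0)"
proof -
  define f where "f t = \<psi> (a, t) + (if 0 < t \<and> t < part s a then 0 else
    weight_above s \<psi> a (filter ((<) a) (takeWhile (\<lambda>x. x \<noteq> a) w)))" for t
  have step: "g (prefix_route s (take (occ w a t) w)) - g (prefix_route s (take (occ w a t + 1) w))
      = f t - f (t - 1)" if t: "t \<in> {1..part s a}" for t
  proof -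
    have "t - 1 < count_list w a" using t stirling_count[OF assms(2,3)] by auto
    then obtain u v where w: "w = u @ [a] @ v" "count_list u a = t - 1" by (rule split_at_occurrence)
    have "Suc (count_list u a) = t" using w(2) t by simp
    then have occ: "occ w a t = length u" using occ_append[of u a v] w(1) by simp
    have stir: "stirling_perm s (u @ [a] @ v)" "stirling_perm s ((u @ [a]) @ v)" using assms(2) w(1) by simp_all
    let ?L = "\<Sum>i\<in>{1..<a}. \<psi> (i, count_list u i)"
    have filt: "filter ((<) a) u = filter ((<) a) (takeWhile (\<lambda>x. x \<noteq> a) w)"
      using stirling_filter_greater[OF stir(1)] w(1) by simp
    have "weight \<psi> (prefix_route s u) = ?L + f (t - 1)"
      using assms(3) w(2) t
      by (subst weight_prefix_route_split[OF assms(1) bounded_counts_prefix[OF stir(1)] assms(3)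
            stirling_not_partial(1)[OF stir(1)]])
        (auto simp: filt f_def partial_def)
    moreover have "weight \<psi> (prefix_route s (u @ [a])) = ?L + f t"
    proof -
      have "count_list (u @ [a]) a = t" using w(2) t by simp
      moreover have "(\<Sum>i\<in>{1..<a}. \<psi> (i, count_list (u @ [a]) i)) = ?L" by (intro sum.cong) auto
      moreover have "filter ((<) a) (u @ [a]) = filter ((<) a) u" by simp
      ultimately show ?thesis
        using assms(3) t weight_prefix_route_split[OF assms(1) bounded_counts_prefix[OF stir(2)] assms(3)
            stirling_not_partial(2)[OF stir(1)], of \<psi>]
        by (auto simp: filt f_def partial_def)
    qed
    moreover have "g (prefix_route s u) = m - weight \<psi> (prefix_route s u)"
      "g (prefix_route s (u @ [a])) = m - weight \<psi> (prefix_route s (u @ [a]))"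
      using assms(4)[of "prefix_route s u"] assms(4)[of "prefix_route s (u @ [a])"]
        prefix_routesI[of w u "[a] @ v"] prefix_routesI[of w "u @ [a]" v] w(1) by (auto simp: algebra_simps)
    moreover have "take (occ w a t) w = u" "take (occ w a t + 1) w = u @ [a]"
      unfolding occ using w(1) by simp_all
    ultimately show ?thesis by simp
  qed
  have tel: "(\<Sum>t\<in>{1..N}. f t - f (t - 1)) = f N - f 0" for N
    by (induction N) auto
  have "Poly_Mapping.lookup (vert s g w) a = (\<Sum>t\<in>{1..part s a}. f t - f (t - 1))"
    unfolding lookup_vert[OF assms(3)] by (intro sum.cong step) auto
  also have "\<dots> = f (part s a) - f 0" by (rule tel)
  finally show ?thesis by (simp add: f_def)
qed

section \<open>Slacks and vertices of the complex\<close>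

lemma finite_exponents: "finite (exponents k)"
  by (simp add: exponents_def finite_PiE)

lemma minimizers_iff:
  "\<delta> \<in> minimizers s h k t x \<longleftrightarrow>
    \<delta> \<in> exponents k \<and> (\<forall>\<delta>'\<in>exponents k. trop_term s h k t x \<delta> \<le> trop_term s h k t x \<delta>')"
proof -
  have "trop_term s h k t x \<delta> = trop_poly s h k t x \<longleftrightarrow>
      (\<forall>\<delta>'\<in>exponents k. trop_term s h k t x \<delta> \<le> trop_term s h k t x \<delta>')" if "\<delta> \<in> exponents k"
    unfolding trop_poly_def using that finite_exponents by (subst eq_Min_iff) auto
  then show ?thesis by (auto simp: minimizers_def)
qed

text \<open>Switching from bump to dip at level \<open>i\<close> adds the coordinate
  \<open>i\<close> of \<open>x\<close> to the weight. So term and \<open>h + weight\<close> differ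
  by a constant that does not depend on \<delta>.\<close>

lemma trop_term_potential:
  assumes "\<delta> \<in> exponents k"
    and "\<And>i. 1 \<le> i \<Longrightarrow> i < k \<Longrightarrow> Poly_Mapping.lookup x i = \<psi> (i, part s i) - \<psi> (i, 0)"
  shows "trop_term s h k t x \<delta> =
    h (route s k t \<delta>) + weight \<psi> (route s k t \<delta>) - (\<psi> (k, t) + (\<Sum>i\<in>{1..<k}. \<psi> (i, 0)))"
proof -
  have "\<psi> (i, \<delta> i * part s i) = \<psi> (i, 0) + real (\<delta> i) * Poly_Mapping.lookup x i" if "i \<in> {1..<k}" for i
    using exponents_mem[OF assms(1), of i] assms(2)[of i] that by auto
  then have "(\<Sum>i\<in>{1..<k}. \<psi> (i, \<delta> i * part s i)) =
      (\<Sum>i\<in>{1..<k}. \<psi> (i, 0)) + (\<Sum>i\<in>{1..<k}. real (\<delta> i) * Poly_Mapping.lookup x i)"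
    by (simp add: sum.distrib)
  then show ?thesis by (simp add: trop_term_def weight_route)
qed

text \<open>Every point \<open>y\<close> gives an edge potential for which \<open>h + weight\<close> is the slack of a route
  in its tropical polynomial at \<open>y\<close>.\<close>

definition point_potential ::
    "nat list \<Rightarrow> (edge list \<Rightarrow> real) \<Rightarrow> (nat \<Rightarrow>\<^sub>0 real) \<Rightarrow> edge \<Rightarrow> real" where
  "point_potential s h y = (\<lambda>(k, t).
     if t = 0 then 0
     else if k \<in> {1..length s} \<and> t = part s k then Poly_Mapping.lookup y k
     else - trop_poly s h k t y)"

definition slack ::
    "nat list \<Rightarrow> (edge list \<Rightarrow> real) \<Rightarrow> (nat \<Rightarrow>\<^sub>0 real) \<Rightarrow> edge list \<Rightarrow> real" where
  "slack s h y R = h R + weight (point_potential s h y) R"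

lemma point_potential_diff:
  assumes "composition s" "i \<in> {1..length s}"
  shows "point_potential s h y (i, part s i) - point_potential s h y (i, 0) = Poly_Mapping.lookup y i"
  using part_pos[OF assms(1), of i] assms(2) by (simp add: point_potential_def)

text \<open>The potential vanishes on bumps and is minus the minimum on the source edge, which makes
  the constant in \<open>trop_term_potential\<close> equal to \<open>- trop_poly\<close>.\<close>

lemma slack_route:
  assumes "composition s" "k \<in> {1..length s + 1}" "t \<in> {1..part s k - 1}" "\<delta> \<in> exponents k"
  shows "slack s h y (route s k t \<delta>) = trop_term s h k t y \<delta> - trop_poly s h k t y"
proof -
  have "trop_term s h k t y \<delta> = slack s h y (route s k t \<delta>) -
      (point_potential s h y (k, t) + (\<Sum>i\<in>{1..<k}. point_potential s h y (i, 0)))"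
    unfolding slack_def using point_potential_diff[OF assms(1)] assms(2)
    by (intro trop_term_potential[OF assms(4)]) (simp add: order.strict_implies_order)
  moreover have "point_potential s h y (k, t) = - trop_poly s h k t y"
    using assms(3) by (auto simp: point_potential_def)
  ultimately show ?thesis by (simp add: point_potential_def)
qed

lemma slack_nonneg:
  assumes "composition s" "R \<in> routes s"
  shows "0 \<le> slack s h y R"
proof -
  obtain k t \<delta> where R: "k \<in> {1..length s + 1}" "t \<in> {1..part s k - 1}" "\<delta> \<in> exponents k" "R = route s k t \<delta>"
    using routes_eq[OF assms] .
  have "trop_poly s h k t y \<le> trop_term s h k t y \<delta>"
    unfolding trop_poly_def using R(3) finite_exponents by (intro Min_le) auto
  then show ?thesis using slack_route[OF assms(1) R(1-3)] R(4) by simp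
qed

lemma slack_zero_iff:
  assumes "composition s" "k \<in> {1..length s + 1}" "t \<in> {1..part s k - 1}" "\<delta> \<in> exponents k"
  shows "slack s h y (route s k t \<delta>) = 0 \<longleftrightarrow> \<delta> \<in> minimizers s h k t y"
  using slack_route[OF assms] assms(4) by (simp add: minimizers_def)

text \<open>For \<open>k = 1\<close> there is a single exponent. This covers the routes consisting
  of one source edge, whose index is absent from \<open>hypersurface_indices\<close>.\<close>

lemma minimizers_one:
  assumes "\<delta> \<in> exponents 1"
  shows "\<delta> \<in> minimizers s h 1 t y"
  using assms by (auto simp: minimizers_iff exponents_def)

lemma cell_slack_zero:
  assumes "composition s" "R \<in> routes s" "y \<in> arrangement_cell s h z" "slack s h z R = 0"
  shows "slack s h y R = 0"
proof -
  obtain k t \<delta> where R: "k \<in> {1..length s + 1}" "t \<in> {1..part s k - 1}" "\<delta> \<in> exponents k" "R = route s k t \<delta>"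
    using routes_eq[OF assms(1,2)] .
  have "\<delta> \<in> minimizers s h k t y"
  proof (cases "k = 1")
    case True
    then show ?thesis using minimizers_one R(3) by simp
  next
    case False
    then have "(k, t) \<in> hypersurface_indices s" using R(1,2) by (auto simp: hypersurface_indices_def)
    moreover have "\<delta> \<in> minimizers s h k t z"
      using slack_zero_iff[OF assms(1) R(1-3)] R(4) assms(4) by simp
    ultimately show ?thesis using assms(3) by (auto simp: arrangement_cell_def)
  qed
  then show ?thesis using slack_zero_iff[OF assms(1) R(1-3)] R(4) by simp
qed

lemma arrangement_cell_self: "x \<in> euclidean (length s) \<Longrightarrow> x \<in> arrangement_cell s h x"
  by (auto simp: arrangement_cell_def)

lemma prefix_routes_type:
  assumes "composition s" "stirling_perm s w" "k \<in> {1..length s + 1}" "t \<in> {1..part s k - 1}"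
  obtains \<delta> where "\<delta> \<in> exponents k" "route s k t \<delta> \<in> prefix_routes s w"
proof -
  obtain u v where u: "w = u @ v" "active_letter s u = k" "level s u k = t"
    using prefix_of_type[OF assms] .
  have "bounded_counts s u" using bounded_counts_prefix assms(2) u(1) by simp
  then show ?thesis using prefix_route_exponents[OF assms(1)] prefix_routesI[OF u(1)] u(2,3) that by metis
qed

text \<open>The potential \<psi> exposing the clique has bump-dip differences equal to the
  coordinates of \<open>vert s h w\<close>; hence \<open>h + weight\<close> and the slack there
  agree up to a constant.\<close>

lemma slack_vert_zero_iff:
  assumes "composition s" "admissible s h" "stirling_perm s w" "R \<in> routes s"
  shows "slack s h (vert s h w) R = 0 \<longleftrightarrow> R \<in> prefix_routes s w"
proof -
  let ?x = "vert s h w" and ?C = "prefix_routes s w"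
  have "prefix_route s [] \<in> ?C" by (rule prefix_routesI[of w "[]" w]) simp
  then have "?C \<noteq> {}" by blast
  then obtain \<psi> m where le: "\<And>R. R \<in> routes s \<Longrightarrow> m \<le> h R + weight \<psi> R"
    and eq: "\<And>R. R \<in> routes s \<Longrightarrow> h R + weight \<psi> R = m \<longleftrightarrow> R \<in> ?C"
  proof (rule admissible_potential[OF assms(1,2) _ prefix_routes_subset[OF assms(1,3)]
          prefix_routes_coherent[OF assms(1,3)]])
    fix \<psi> m
    assume le: "\<And>R. R \<in> routes s \<Longrightarrow> m \<le> h R + weight \<psi> R"
      and eq: "\<And>R. R \<in> routes s \<Longrightarrow> h R + weight \<psi> R = m \<longleftrightarrow> R \<in> ?C"
    show thesis by (rule that[OF le eq])
  qed
  have x: "Poly_Mapping.lookup ?x i = \<psi> (i, part s i) - \<psi> (i, 0)" if "i \<in> {1..length s}" for i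
    using eq prefix_routes_subset[OF assms(1,3)] that
    by (intro lookup_vert_potential[OF assms(1,3)]) auto
  obtain k t \<delta> where R: "k \<in> {1..length s + 1}" "t \<in> {1..part s k - 1}" "\<delta> \<in> exponents k" "R = route s k t \<delta>"
    using routes_eq[OF assms(1,4)] .
  define c where "c = \<psi> (k, t) + (\<Sum>i\<in>{1..<k}. \<psi> (i, 0))"
  have trop: "trop_term s h k t ?x \<epsilon> = h (route s k t \<epsilon>) + weight \<psi> (route s k t \<epsilon>) - c"
    if "\<epsilon> \<in> exponents k" for \<epsilon>
    unfolding c_def using x R(1) by (intro trop_term_potential[OF that]) auto
  have route: "route s k t \<epsilon> \<in> routes s" if "\<epsilon> \<in> exponents k" for \<epsilon>
    using route_in_routes[OF assms(1) R(1,2)] exponents_mem[OF that] by blast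
  \<comment> \<open>A clique member with the same source edge attains \<open>m\<close>, which fixes
    the minimum of this polynomial as \<open>m - c\<close>.\<close>
  obtain \<delta>0 where \<delta>0: "\<delta>0 \<in> exponents k" "route s k t \<delta>0 \<in> ?C"
    using prefix_routes_type[OF assms(1,3) R(1,2)] .
  have "trop_poly s h k t ?x = m - c"
    unfolding trop_poly_def
  proof (rule Min_eqI)
    show "finite (trop_term s h k t ?x ` exponents k)" using finite_exponents by blast
    show "m - c \<le> y" if "y \<in> trop_term s h k t ?x ` exponents k" for y
      using that trop le route by fastforce
    have "trop_term s h k t ?x \<delta>0 = m - c" using trop[OF \<delta>0(1)] eq route[OF \<delta>0(1)] \<delta>0(2) by simp
    then show "m - c \<in> trop_term s h k t ?x ` exponents k" using \<delta>0(1) by (metis imageI)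
  qed
  then have "slack s h ?x R = h R + weight \<psi> R - m"
    using slack_route[OF assms(1) R(1-3)] trop[OF R(3)] R(4) by simp
  then show ?thesis using eq[OF assms(4)] by simp
qed

text \<open>Slack 0 on the clique says that \<open>h\<close> plus the weight of
  \<open>point_potential s h y\<close> is constantly 0 there, and the bump-dip differences of this
  potential are the coordinates of \<open>y\<close>.\<close>

lemma vert_eqI:
  assumes "composition s" "stirling_perm s w" "y \<in> euclidean (length s)"
    and "\<And>R. R \<in> prefix_routes s w \<Longrightarrow> slack s h y R = 0"
  shows "vert s h w = y"
proof (rule euclidean_eqI[OF vert_in_euclidean assms(3)])
  fix b assume b: "b \<in> {1..length s}"
  show "Poly_Mapping.lookup (vert s h w) b = Poly_Mapping.lookup y b"
    unfolding point_potential_diff[OF assms(1) b, symmetric, of y h]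
    using assms(4) by (intro lookup_vert_potential[OF assms(1,2) b, where m = 0]) (simp add: slack_def)
qed

text \<open>Every point of the cell of \<open>vert s h w\<close> keeps slack 0 on the clique and so
  equals \<open>vert s h w\<close> by \<open>vert_eqI\<close>.\<close>

lemma Perm_vertex_vert:
  assumes "composition s" "admissible s h" "stirling_perm s w"
  shows "Perm_vertex s h (vert s h w)"
proof -
  let ?x = "vert s h w"
  have "arrangement_cell s h ?x = {?x}"
  proof
    show "arrangement_cell s h ?x \<subseteq> {?x}"
    proof
      fix y assume y: "y \<in> arrangement_cell s h ?x"
      then have "y \<in> euclidean (length s)" by (simp add: arrangement_cell_def)
      moreover have "slack s h y R = 0" if "R \<in> prefix_routes s w" for R
        using cell_slack_zero[OF assms(1) _ y] slack_vert_zero_iff[OF assms] that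
          prefix_routes_subset[OF assms(1,3)] by blast
      ultimately show "y \<in> {?x}" using vert_eqI[OF assms(1,3)] by blast
    qed
    show "{?x} \<subseteq> arrangement_cell s h ?x" using arrangement_cell_self[OF vert_in_euclidean] by blast
  qed
  then show ?thesis
    using vert_in_euclidean[of s h w] unfolding Perm_vertex_def Perm_def by (auto simp: image_iff)
qed

text \<open>\<open>vert\<close> is additive in the height, and \<open>h\<close> is the slack minus
  the weight; the latter contributes exactly \<open>y\<close>.\<close>

lemma vert_eq_add_vert_slack:
  assumes "composition s" "stirling_perm s w" "y \<in> euclidean (length s)"
  shows "vert s h w = y + vert s (slack s h y) w"
proof (rule euclidean_eqI[OF vert_in_euclidean])
  show "y + vert s (slack s h y) w \<in> euclidean (length s)"
    using assms(3) vert_in_euclidean[of s "slack s h y" w] Poly_Mapping.keys_add[of y "vert s (slack s h y) w"]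
    unfolding euclidean_def mem_Collect_eq by (meson Un_least order_trans)
  fix b assume b: "b \<in> {1..length s}"
  let ?\<psi> = "point_potential s h y"
  have "Poly_Mapping.lookup (vert s h w) b =
      Poly_Mapping.lookup (vert s (\<lambda>R. - weight ?\<psi> R) w) b + Poly_Mapping.lookup (vert s (slack s h y) w) b"
    unfolding lookup_vert[OF b] sum.distrib[symmetric] by (simp add: slack_def)
  also have "Poly_Mapping.lookup (vert s (\<lambda>R. - weight ?\<psi> R) w) b = Poly_Mapping.lookup y b"
    unfolding point_potential_diff[OF assms(1) b, symmetric, of y h]
    by (intro lookup_vert_potential[OF assms(1,2) b, where m = 0]) simp
  finally show "Poly_Mapping.lookup (vert s h w) b = Poly_Mapping.lookup (y + vert s (slack s h y) w) b"
    by (simp add: lookup_add)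
qed

lemma lookup_vert_positions:
  assumes "stirling_perm s w" "b \<in> {1..length s}"
  shows "Poly_Mapping.lookup (vert s g w) b =
    (\<Sum>i | i < length w \<and> w ! i = b. g (prefix_route s (take i w)) - g (prefix_route s (take (Suc i) w)))"
proof -
  let ?l = "filter (\<lambda>i. w ! i = b) [0..<length w]"
  let ?f = "\<lambda>i. g (prefix_route s (take i w)) - g (prefix_route s (take (Suc i) w))"
  have "length ?l = count_list w b"
    unfolding count_list_eq_length_filter length_filter_conv_card
    by (auto simp: distinct_length_filter intro!: arg_cong[where f = card])
  then have len: "length ?l = part s b" using stirling_count[OF assms] by simp
  have "Poly_Mapping.lookup (vert s g w) b = (\<Sum>t\<in>{1..part s b}. ?f (?l ! (t - 1)))"
    unfolding lookup_vert[OF assms(2)] occ_def by simp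
  also have "\<dots> = (\<Sum>t<length ?l. ?f (?l ! t))"
    unfolding len by (rule sum.reindex_bij_witness[of _ Suc "\<lambda>t. t - 1"]) auto
  also have "\<dots> = sum_list (map ?f ?l)"
    by (simp add: sum_list_sum_nth atLeast0LessThan)
  also have "\<dots> = sum ?f (set ?l)" by (rule sum_list_distinct_conv_sum_set) simp
  also have "set ?l = {i. i < length w \<and> w ! i = b}" by auto
  finally show ?thesis .
qed

text \<open>The prefix \<open>u @ [x]\<close> enters the sums twice: positively as the prefix before
  the following letter \<open>y\<close>, negatively as the prefix that ends with
  \<open>x\<close>.\<close>

lemma vert_single_prefix:
  assumes "stirling_perm s w" "w = u @ [x] @ [y] @ v"
    and "\<And>p q. w = p @ q \<Longrightarrow> p \<noteq> u @ [x] \<Longrightarrow> g (prefix_route s p) = 0"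
  shows "vert s g w = g (prefix_route s (u @ [x])) *\<^sub>R (Poly_Mapping.single y 1 - Poly_Mapping.single x 1)"
proof (rule euclidean_eqI[OF vert_in_euclidean])
  let ?D = "g (prefix_route s (u @ [x]))" and ?j = "Suc (length u)"
  have xy: "x \<in> {1..length s}" "y \<in> {1..length s}"
    using stirling_set[OF assms(1)] assms(2) by auto
  show "?D *\<^sub>R (Poly_Mapping.single y 1 - Poly_Mapping.single x 1) \<in> euclidean (length s)"
    using xy by (auto simp: euclidean_def in_keys_iff lookup_minus lookup_single when_def split: if_splits)
  fix b assume b: "b \<in> {1..length s}"
  have f: "g (prefix_route s (take i w)) = (if i = ?j then ?D else 0)" if "i \<le> length w" for i
  proof (cases "i = ?j")
    case True
    then show ?thesis by (simp add: assms(2))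
  next
    case False
    then have "length (take i w) \<noteq> length (u @ [x])" using that by simp
    then have "take i w \<noteq> u @ [x]" by metis
    then show ?thesis using False assms(3)[of "take i w" "drop i w"] by simp
  qed
  let ?A = "{i. i < length w \<and> w ! i = b}"
  have A: "finite ?A" "?j \<in> ?A \<longleftrightarrow> y = b" "length u \<in> ?A \<longleftrightarrow> x = b"
    by (auto simp: assms(2) nth_append)
  \<comment> \<open>The prefix of length \<open>Suc i\<close> is the exceptional one for
    \<open>i = length u\<close>, the position of \<open>x\<close>.\<close>
  have "Poly_Mapping.lookup (vert s g w) b =
      (\<Sum>i\<in>?A. (if i = ?j then ?D else 0) - (if i = length u then ?D else 0))"
    unfolding lookup_vert_positions[OF assms(1) b] by (intro sum.cong) (auto simp: f)
  also have "\<dots> = (if y = b then ?D else 0) - (if x = b then ?D else 0)"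
    using A by (simp add: sum_subtractf sum.delta')
  finally show "Poly_Mapping.lookup (vert s g w) b =
      Poly_Mapping.lookup (?D *\<^sub>R (Poly_Mapping.single y 1 - Poly_Mapping.single x 1)) b"
    by (simp add: lookup_minus lookup_single when_def)
qed

section \<open>Minimisers along segments\<close>

lemma trop_term_segment:
  "trop_term s h k t ((1 - u) *\<^sub>R x + u *\<^sub>R y) \<delta> =
    (1 - u) * trop_term s h k t x \<delta> + u * trop_term s h k t y \<delta>"
proof -
  have "(\<Sum>i\<in>{1..<k}. real (\<delta> i) * Poly_Mapping.lookup ((1 - u) *\<^sub>R x + u *\<^sub>R y) i) =
      (1 - u) * (\<Sum>i\<in>{1..<k}. real (\<delta> i) * Poly_Mapping.lookup x i) +
      u * (\<Sum>i\<in>{1..<k}. real (\<delta> i) * Poly_Mapping.lookup y i)"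
    unfolding sum_distrib_left sum.distrib[symmetric]
    unfolding lookup_add lookup_scaleR real_scaleR_def by (intro sum.cong) (auto simp: algebra_simps)
  then show ?thesis by (simp add: trop_term_def algebra_simps)
qed

lemma minimizers_segment_supset:
  assumes "0 \<le> u" "u \<le> 1"
  shows "minimizers s h k t x \<inter> minimizers s h k t y \<subseteq> minimizers s h k t ((1 - u) *\<^sub>R x + u *\<^sub>R y)"
  using assms by (auto simp: minimizers_iff trop_term_segment intro!: add_mono mult_left_mono)

text \<open>Terms are affine on the segment. With a common minimiser at both ends, a term that is
  minimal at an inner point cannot exceed the minimum at either end.\<close>

lemma minimizers_open_segment:
  assumes "0 < u" "u < 1" "minimizers s h k t x \<inter> minimizers s h k t y \<noteq> {}"
  shows "minimizers s h k t ((1 - u) *\<^sub>R x + u *\<^sub>R y) = minimizers s h k t x \<inter> minimizers s h k t y"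
proof
  show "minimizers s h k t x \<inter> minimizers s h k t y \<subseteq> minimizers s h k t ((1 - u) *\<^sub>R x + u *\<^sub>R y)"
    using assms by (intro minimizers_segment_supset) auto
  obtain \<delta>0 where \<delta>0: "\<delta>0 \<in> minimizers s h k t x" "\<delta>0 \<in> minimizers s h k t y" using assms(3) by blast
  let ?T = "trop_term s h k t"
  show "minimizers s h k t ((1 - u) *\<^sub>R x + u *\<^sub>R y) \<subseteq> minimizers s h k t x \<inter> minimizers s h k t y"
  proof
    fix \<delta> assume \<delta>: "\<delta> \<in> minimizers s h k t ((1 - u) *\<^sub>R x + u *\<^sub>R y)"
    then have "\<delta> \<in> exponents k" and
      le: "(1 - u) * ?T x \<delta> + u * ?T y \<delta> \<le> (1 - u) * ?T x \<delta>0 + u * ?T y \<delta>0"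
      using \<delta>0(1) by (auto simp: minimizers_iff trop_term_segment)
    have x: "?T x \<delta>0 \<le> ?T x \<delta>" and y: "?T y \<delta>0 \<le> ?T y \<delta>"
      using \<delta>0 \<open>\<delta> \<in> exponents k\<close> by (auto simp: minimizers_iff)
    have "(1 - u) * ?T x \<delta>0 \<le> (1 - u) * ?T x \<delta>" "u * ?T y \<delta>0 \<le> u * ?T y \<delta>"
      using x y assms by (auto intro: mult_left_mono)
    with le have "(1 - u) * ?T x \<delta>0 = (1 - u) * ?T x \<delta>" "u * ?T y \<delta>0 = u * ?T y \<delta>" by linarith+
    then have "?T x \<delta>0 = ?T x \<delta>" "?T y \<delta>0 = ?T y \<delta>" using assms by auto
    then show "\<delta> \<in> minimizers s h k t x \<inter> minimizers s h k t y"
      using \<delta>0 \<open>\<delta> \<in> exponents k\<close> by (auto simp: minimizers_iff)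
  qed
qed

lemma between_in_closed_segment:
  fixes y d :: "'a::real_vector"
  assumes "0 \<le> p" "0 \<le> q"
  shows "y \<in> closed_segment (y + p *\<^sub>R - d) (y + q *\<^sub>R d)"
proof (cases "p + q = 0")
  case True
  then have "p = 0" "q = 0" using assms by auto
  then show ?thesis by simp
next
  case False
  \<comment> \<open>The parameter at which the displacements \<open>p\<close> and \<open>q\<close>
    in opposite directions cancel.\<close>
  define u where "u = p / (p + q)"
  have u: "0 \<le> u" "u \<le> 1" using assms False by (auto simp: u_def field_simps)
  have "u * q = (1 - u) * p" using False by (simp add: u_def field_simps)
  moreover have "(1 - u) *\<^sub>R (y + p *\<^sub>R - d) + u *\<^sub>R (y + q *\<^sub>R d) = y + (u * q - (1 - u) * p) *\<^sub>R d"
    by (simp add: algebra_simps)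
  ultimately have "(1 - u) *\<^sub>R (y + p *\<^sub>R - d) + u *\<^sub>R (y + q *\<^sub>R d) = y" by simp
  then show ?thesis using u by (auto simp: in_segment)
qed

section \<open>Edges of the complex\<close>

lemma slack_segment_zero:
  assumes "composition s" "R \<in> routes s" "slack s h x R = 0" "slack s h y R = 0" "0 \<le> u" "u \<le> 1"
  shows "slack s h ((1 - u) *\<^sub>R x + u *\<^sub>R y) R = 0"
proof -
  obtain k t \<delta> where R: "k \<in> {1..length s + 1}" "t \<in> {1..part s k - 1}" "\<delta> \<in> exponents k" "R = route s k t \<delta>"
    using routes_eq[OF assms(1,2)] .
  then show ?thesis
    using minimizers_segment_supset[OF assms(5,6)] assms(3,4) slack_zero_iff[OF assms(1) R(1-3)] by blast
qed

lemma euclidean_segment: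
  assumes "x \<in> euclidean n" "y \<in> euclidean n"
  shows "(1 - u) *\<^sub>R x + u *\<^sub>R y \<in> euclidean n"
proof -
  have "Poly_Mapping.lookup ((1 - u) *\<^sub>R x + u *\<^sub>R y) b = 0" if "b \<notin> {1..n}" for b
  proof -
    have "b \<notin> Poly_Mapping.keys x" "b \<notin> Poly_Mapping.keys y" using assms that by (auto simp: euclidean_def)
    then show ?thesis by (simp add: lookup_add in_keys_iff)
  qed
  then show ?thesis unfolding euclidean_def in_keys_iff subset_iff by blast
qed

text \<open>The segment is the cell of its midpoint. By \<open>cover\<close> each polynomial has a
  minimiser common to both ends, so the midpoint has exactly the common minimisers;
  \<open>segment\<close> then bounds its cell.\<close>

lemma segment_in_Perm:
  assumes "composition s" "admissible s h" "stirling_perm s w" "stirling_perm s w'"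
    and cover: "\<And>k t. (k, t) \<in> hypersurface_indices s \<Longrightarrow>
      \<exists>\<delta>\<in>exponents k. route s k t \<delta> \<in> prefix_routes s w \<inter> prefix_routes s w'"
    and segment: "\<And>y. y \<in> euclidean (length s) \<Longrightarrow>
      (\<And>R. R \<in> prefix_routes s w \<inter> prefix_routes s w' \<Longrightarrow> slack s h y R = 0) \<Longrightarrow>
      y \<in> closed_segment (vert s h w) (vert s h w')"
  shows "closed_segment (vert s h w) (vert s h w') \<in> Perm s h"
proof -
  let ?x = "vert s h w" and ?x' = "vert s h w'"
  define z where "z = (1 - 1/2) *\<^sub>R ?x + (1/2) *\<^sub>R ?x'"
  have z: "z \<in> euclidean (length s)"
    unfolding z_def by (intro euclidean_segment vert_in_euclidean)
  have slack0: "slack s h ?x R = 0" "slack s h ?x' R = 0" "R \<in> routes s"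
    if "R \<in> prefix_routes s w \<inter> prefix_routes s w'" for R
    using that prefix_routes_subset[OF assms(1,3)] slack_vert_zero_iff[OF assms(1-3)]
      slack_vert_zero_iff[OF assms(1,2,4)] by auto
  have min_z: "minimizers s h k t z = minimizers s h k t ?x \<inter> minimizers s h k t ?x'"
    if kt: "(k, t) \<in> hypersurface_indices s" for k t
  proof -
    obtain \<delta> where \<delta>: "\<delta> \<in> exponents k" "route s k t \<delta> \<in> prefix_routes s w \<inter> prefix_routes s w'"
      using cover[OF kt] by blast
    have k: "k \<in> {1..length s + 1}" and t: "t \<in> {1..part s k - 1}"
      using kt by (auto simp: hypersurface_indices_def)
    have "\<delta> \<in> minimizers s h k t ?x \<inter> minimizers s h k t ?x'"
      using slack0(1,2)[OF \<delta>(2)] unfolding slack_zero_iff[OF assms(1) k t \<delta>(1)] by (rule IntI)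
    then show ?thesis unfolding z_def by (intro minimizers_open_segment) auto
  qed
  have "arrangement_cell s h z = closed_segment ?x ?x'"
  proof
    show "arrangement_cell s h z \<subseteq> closed_segment ?x ?x'"
    proof
      fix y assume y: "y \<in> arrangement_cell s h z"
      show "y \<in> closed_segment ?x ?x'"
      proof (rule segment)
        show "y \<in> euclidean (length s)" using y by (simp add: arrangement_cell_def)
        fix R assume R: "R \<in> prefix_routes s w \<inter> prefix_routes s w'"
        have "slack s h z R = 0"
          unfolding z_def using slack0[OF R] by (intro slack_segment_zero[OF assms(1)]) auto
        then show "slack s h y R = 0" using cell_slack_zero[OF assms(1) slack0(3)[OF R] y] by simp
      qed
    qed
    show "closed_segment ?x ?x' \<subseteq> arrangement_cell s h z"
    proof
      fix y assume "y \<in> closed_segment ?x ?x'"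
      then obtain u where u: "0 \<le> u" "u \<le> 1" "y = (1 - u) *\<^sub>R ?x + u *\<^sub>R ?x'"
        by (auto simp: in_segment)
      have "y \<in> euclidean (length s)" unfolding u(3) by (intro euclidean_segment vert_in_euclidean)
      moreover have "minimizers s h k t z \<subseteq> minimizers s h k t y" if "(k, t) \<in> hypersurface_indices s" for k t
        unfolding min_z[OF that] u(3) by (rule minimizers_segment_supset[OF u(1,2)])
      ultimately show "y \<in> arrangement_cell s h z" by (auto simp: arrangement_cell_def)
    qed
  qed
  then have "closed_segment ?x ?x' \<in> arrangement_cell s h ` euclidean (length s)"
    using z by (rule image_eqI[OF sym])
  then show ?thesis unfolding Perm_def by (simp add: bounded_closed_segment)
qed

section \<open>Exchanging a block with the letter that follows it\<close>

locale block_exchange =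
  fixes s :: "nat list" and a c :: nat and w w' u1 u2 B :: "nat list"
  assumes comp: "composition s"
    and a_pos: "1 \<le> a" and a_less_c: "a < c" and c_le: "c \<le> length s"
    and stir: "stirling_perm s w" and stir': "stirling_perm s w'"
    and block: "is_block w a B"
    and w_eq: "w = u1 @ B @ [c] @ u2"
    and w'_eq: "w' = u1 @ [c] @ B @ u2"
begin

lemma a_in: "a \<in> {1..length s}"
  using a_pos a_less_c c_le by auto

lemma block_ends: "B \<noteq> []" "hd B = a" "last B = a"
proof -
  have "count_list w a \<noteq> 0" using stirling_count[OF stir a_in] part_pos[OF comp, of a] a_in by auto
  then have "a \<in> set w" by (simp add: count_list_0_iff)
  from is_block_ends[OF block this] show "B \<noteq> []" "hd B = a" "last B = a" .
qed

lemma block_count: "count_list B a = part s a" "count_list u1 a = 0"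
proof -
  have "count_list B a = count_list w a"
    using block by (simp add: is_block_def is_arg_min_def)
  then show "count_list B a = part s a" "count_list u1 a = 0"
    using stirling_count[OF stir a_in] by (simp_all add: w_eq)
qed

text \<open>A larger letter in \<open>B\<close> would lie between its first and last letters, both
  equal to \<open>a\<close>.\<close>

lemma block_le: "b \<in> set B \<Longrightarrow> b \<le> a"
proof (rule ccontr)
  assume b: "b \<in> set B" "\<not> b \<le> a"
  then obtain B1 B2 where B: "B = B1 @ [b] @ B2" by (metis append_Cons append_Nil split_list)
  have "B1 \<noteq> []" "B2 \<noteq> []" using block_ends b(2) by (auto simp: B)
  then have "hd B1 = a" "last B2 = a" using block_ends by (simp_all add: B)
  then have "a \<in> set B1" "a \<in> set B2"
    using hd_in_set[OF \<open>B1 \<noteq> []\<close>] last_in_set[OF \<open>B2 \<noteq> []\<close>] by simp_all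
  moreover have "stirling_perm s ((u1 @ B1) @ [b] @ (B2 @ [c] @ u2))" using stir by (simp add: w_eq B)
  ultimately show False using stirling_no_121[of s "u1 @ B1" b "B2 @ [c] @ u2" a] b(2) by auto
qed

lemma block_count_above: "a < b \<Longrightarrow> count_list B b = 0"
  using block_le[of b] by (simp add: count_list_0_iff) (meson not_less)

text \<open>Strictly inside the block \<open>a\<close> is partially used, so the larger letter
  \<open>c\<close> has no influence on the route.\<close>

lemma prefix_route_inside_block:
  assumes "B = B1 @ B2" "B1 \<noteq> []" "B2 \<noteq> []"
  shows "prefix_route s (u1 @ B1) = prefix_route s (u1 @ [c] @ B1)"
proof (rule prefix_route_eqI_partial[OF comp])
  show "bounded_counts s (u1 @ B1)"
    using bounded_counts_prefix[of s "u1 @ B1" "B2 @ [c] @ u2"] stir by (simp add: w_eq assms(1))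
  show "bounded_counts s (u1 @ [c] @ B1)"
    using bounded_counts_prefix[of s "u1 @ [c] @ B1" "B2 @ u2"] stir' by (simp add: w'_eq assms(1))
  have "a \<in> set B1" "a \<in> set B2"
    using block_ends assms hd_in_set[of B1] last_in_set[of B2] by auto
  then have "count_list B1 a \<noteq> 0" "count_list B2 a \<noteq> 0" by (simp_all add: count_list_0_iff)
  then show "partial s (u1 @ B1) a"
    using block_count a_in by (auto simp: partial_def assms(1))
  show "count_list (u1 @ B1) i = count_list (u1 @ [c] @ B1) i" if "i \<le> a" for i
    using that a_less_c by simp
qed

text \<open>Prefixes of \<open>u1\<close> are shared, cuts inside \<open>B\<close> are handled by
  \<open>prefix_route_inside_block\<close>, and once both \<open>B\<close> and \<open>c\<close> are
  read only the order of letters differs.\<close>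

lemma prefix_route_in_exchanged:
  assumes "w = p @ q" "p \<noteq> u1 @ B"
  shows "prefix_route s p \<in> prefix_routes s w'"
proof -
  have "p @ q = u1 @ B @ ([c] @ u2)" using assms(1) by (simp add: w_eq)
  then show ?thesis
  proof (cases rule: prefix_split_append)
    case (1 p')
    then show ?thesis by (intro prefix_routesI[of _ _ "p' @ [c] @ B @ u2"]) (simp add: w'_eq)
  next
    case (2 B1 B2)
    then show ?thesis
      unfolding 2(4) prefix_route_inside_block[OF 2(3,1,2)]
      by (intro prefix_routesI[of _ _ "B2 @ u2"]) (simp add: w'_eq)
  next
    case (3 p')
    with assms(2) obtain p'' where p'': "p' = c # p''" "u2 = p'' @ q" by (cases p') auto
    have "prefix_route s p = prefix_route s (u1 @ [c] @ B @ p'')"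
      by (rule prefix_route_count_cong) (simp add: 3(1) p'')
    then show ?thesis using prefix_routesI[of w' "u1 @ [c] @ B @ p''" q s] by (simp add: w'_eq p'')
  qed
qed

lemma prefix_route_in_original:
  assumes "w' = p @ q" "p \<noteq> u1 @ [c]"
  shows "prefix_route s p \<in> prefix_routes s w"
proof -
  have "p @ q = u1 @ ([c] @ B) @ u2" using assms(1) by (simp add: w'_eq)
  then show ?thesis
  proof (cases rule: prefix_split_append)
    case (1 p')
    then show ?thesis by (intro prefix_routesI[of _ _ "p' @ B @ [c] @ u2"]) (simp add: w_eq)
  next
    case (2 B1 B2)
    then obtain B1' where B1: "B1 = c # B1'" "B = B1' @ B2" by (cases B1) auto
    with 2 assms(2) have "B1' \<noteq> []" by auto
    then have "prefix_route s p = prefix_route s (u1 @ B1')"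
      using prefix_route_inside_block[OF B1(2) _ 2(2)] 2(4) B1(1) by simp
    then show ?thesis using prefix_routesI[of w "u1 @ B1'" "B2 @ [c] @ u2" s] by (simp add: w_eq B1(2))
  next
    case (3 p')
    have "prefix_route s p = prefix_route s (u1 @ B @ [c] @ p')"
      by (rule prefix_route_count_cong) (simp add: 3(1))
    then show ?thesis using prefix_routesI[of w "u1 @ B @ [c] @ p'" q s] by (simp add: w_eq 3(2))
  qed
qed

lemma stir_assoc:
  "stirling_perm s ((u1 @ B) @ [c] @ u2)" "stirling_perm s (u1 @ [c] @ (B @ u2))"
  "stirling_perm s ((u1 @ B @ [c]) @ u2)" "stirling_perm s ((u1 @ [c]) @ (B @ u2))"
  using stir stir' by (simp_all add: w_eq w'_eq)

lemma bounded_counts_around: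
  "bounded_counts s u1" "bounded_counts s (u1 @ B)" "bounded_counts s (u1 @ [c])" "bounded_counts s (u1 @ B @ [c])"
  by (rule bounded_counts_prefix[OF stir_assoc(2)] bounded_counts_prefix[OF stir_assoc(1)]
      bounded_counts_prefix[OF stir_assoc(4)] bounded_counts_prefix[OF stir_assoc(3)])+

text \<open>Next to \<open>c\<close> no letter below \<open>c\<close> is partially used, and from
  \<open>c\<close> on \<open>B\<close> contributes nothing to the counts.\<close>

lemma active_letter_block:
  "active_letter s (u1 @ B) = active_letter s u1"
  "active_letter s (u1 @ B @ [c]) = active_letter s (u1 @ [c])"
proof -
  have "partial s (u1 @ B) b \<longleftrightarrow> partial s u1 b" for b
  proof (cases "b < c")
    case True
    then show ?thesis
      using stirling_not_partial(1)[OF stir_assoc(1)] stirling_not_partial(1)[OF stir_assoc(2)] by blast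
  next
    case False
    then show ?thesis using block_count_above[of b] a_less_c by (simp add: partial_def)
  qed
  then show "active_letter s (u1 @ B) = active_letter s u1" by (rule active_letter_cong)
  have "partial s (u1 @ B @ [c]) b \<longleftrightarrow> partial s (u1 @ [c]) b" for b
  proof (cases "b < c")
    case True
    then show ?thesis
      using stirling_not_partial(2)[OF stir_assoc(1)] stirling_not_partial(2)[OF stir_assoc(2)] by simp
  next
    case False
    then show ?thesis using block_count_above[of b] a_less_c by (simp add: partial_def)
  qed
  then show "active_letter s (u1 @ B @ [c]) = active_letter s (u1 @ [c])" by (rule active_letter_cong)
qed

lemma active_letter_ge: "c \<le> active_letter s u1" "c \<le> active_letter s (u1 @ [c])"
  using active_ge_next_letter[OF stir_assoc(2)] by simp_all

text \<open>The one exceptional prefix \<open>u1 @ B\<close> has the same source edge as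
  \<open>u1\<close>, whose route lies in both cliques and replaces it.\<close>

lemma common_route_of_type:
  assumes "k \<in> {1..length s + 1}" "t \<in> {1..part s k - 1}"
  shows "\<exists>\<delta>\<in>exponents k. route s k t \<delta> \<in> prefix_routes s w \<inter> prefix_routes s w'"
proof -
  obtain p q where p: "w = p @ q" "active_letter s p = k" "level s p k = t"
    using prefix_of_type[OF comp stir assms] .
  obtain p' q' where p': "w = p' @ q'" "p' \<noteq> u1 @ B" "active_letter s p' = k" "level s p' k = t"
  proof (cases "p = u1 @ B")
    case True
    have k: "active_letter s u1 = k" using active_letter_block(1) p(2) unfolding True by (rule trans[OF sym])
    have "count_list B k = 0" using block_count_above active_letter_ge(1) a_less_c k by simp
    then have "level s u1 k = t" using p(3) unfolding True by (simp add: level_def split: if_splits)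
    then show ?thesis using that[OF w_eq _ k] block_ends(1) by simp
  next
    case False
    show ?thesis by (rule that[OF p(1) False p(2,3)])
  qed
  have "bounded_counts s p'" by (rule bounded_counts_prefix[OF stir[unfolded p'(1)]])
  then obtain \<delta> where "\<delta> \<in> exponents k" "prefix_route s p' = route s k t \<delta>"
    using prefix_route_exponents[OF comp] p'(3,4) by metis
  then show ?thesis using prefix_route_in_exchanged[OF p'(1,2)] prefix_routesI[OF p'(1), of s] by auto
qed

text \<open>Cut all four routes at level \<open>a\<close>: appending \<open>c\<close> leaves the
  lower parts unchanged, inserting \<open>B\<close> the upper parts. Each part thus occurs once on
  either side.\<close>

lemma weight_exchange:
  "weight \<psi> (prefix_route s (u1 @ [c])) + weight \<psi> (prefix_route s (u1 @ B)) =
    weight \<psi> (prefix_route s u1) + weight \<psi> (prefix_route s (u1 @ B @ [c]))"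
proof -
  have split: "(\<Sum>i\<in>{1..k}. f i) = (\<Sum>i\<in>{1..a}. f i) + (\<Sum>i\<in>{a<..k}. f i)"
    if "c \<le> k" for k and f :: "nat \<Rightarrow> real"
  proof -
    have "{1..k} = {1..a} \<union> {a<..k}" using that a_pos a_less_c by auto
    then show ?thesis by (simp only:) (rule sum.union_disjoint, auto)
  qed
  have low: "level s (v @ [c]) i = level s v i" if "i \<in> {1..a}" for v i
    using that a_less_c by (simp add: level_def)
  have up: "level s (u1 @ B) i = level s u1 i" "level s (u1 @ B @ [c]) i = level s (u1 @ [c]) i" if "a < i" for i
    using block_count_above[OF that] by (simp_all add: level_def)
  let ?sum = "\<lambda>I u. \<Sum>i\<in>I. \<psi> (i, level s u i)"
  let ?k = "active_letter s u1" and ?l = "active_letter s (u1 @ [c])"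
  have "?sum {1..a} (u1 @ [c]) = ?sum {1..a} u1"
    by (intro sum.cong refl) (simp only: low)
  moreover have "?sum {1..a} ((u1 @ B) @ [c]) = ?sum {1..a} (u1 @ B)"
    by (intro sum.cong refl) (simp only: low)
  moreover have "?sum {a<..?k} (u1 @ B) = ?sum {a<..?k} u1"
    by (intro sum.cong refl) (simp only: up greaterThanAtMost_iff)
  moreover have "?sum {a<..?l} (u1 @ B @ [c]) = ?sum {a<..?l} (u1 @ [c])"
    by (intro sum.cong refl) (simp only: up greaterThanAtMost_iff)
  ultimately show ?thesis
    unfolding weight_prefix_route[OF comp bounded_counts_around(1)] weight_prefix_route[OF comp bounded_counts_around(2)]
      weight_prefix_route[OF comp bounded_counts_around(3)] weight_prefix_route[OF comp bounded_counts_around(4)]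
      active_letter_block split[OF active_letter_ge(1)] split[OF active_letter_ge(2)] append_assoc
    by linarith
qed

text \<open>The route reaches levels \<open>a\<close> and \<open>c\<close>, hence records no
  \<open>a\<close> and one more \<open>c\<close> than \<open>u1\<close>; a prefix of
  \<open>w\<close> gets this further \<open>c\<close> only after all of \<open>B\<close>.\<close>

lemma new_route_notin: "prefix_route s (u1 @ [c]) \<notin> prefix_routes s w"
proof
  assume "prefix_route s (u1 @ [c]) \<in> prefix_routes s w"
  then obtain p q where p: "w = p @ q" "prefix_route s (u1 @ [c]) = prefix_route s p"
    by (rule prefix_routesE)
  have "bounded_counts s p" by (rule bounded_counts_prefix[OF stir[unfolded p(1)]])
  note eq = prefix_route_eqD(2)[OF comp bounded_counts_around(3) this p(2)]
  have pa: "count_list p a = 0"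
    using eq[of a] a_in active_letter_ge(2) a_less_c block_count(2) by simp
  have pc: "count_list p c = Suc (count_list u1 c)"
    using eq[of c] c_le active_letter_ge(2) a_less_c by simp
  have "p @ q = u1 @ B @ ([c] @ u2)" using p(1) by (simp add: w_eq)
  then show False
  proof (cases rule: prefix_split_append)
    case (1 p')
    then show False using pc by simp
  next
    case (2 B1 B2)
    then have "a \<in> set B1" using block_ends(2) hd_in_set[of B1] by simp
    then show False using pa 2(4) by (simp add: count_list_0_iff)
  next
    case (3 p')
    then show False using pa block_count(1) part_pos[OF comp, of a] a_in by simp
  qed
qed

text \<open>Only one prefix of each word can have nonzero slack at \<open>y\<close>. In
  \<open>w\<close> it ends with \<open>a\<close> and \<open>c\<close> follows, in \<open>w'\<close>
  it ends with \<open>c\<close> and \<open>a\<close> follows, which explains the opposite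
  signs.\<close>

lemma vert_eq_add_slack:
  assumes "y \<in> euclidean (length s)"
    and "\<And>R. R \<in> prefix_routes s w \<inter> prefix_routes s w' \<Longrightarrow> slack s h y R = 0"
  shows "vert s h w = y + slack s h y (prefix_route s (u1 @ B)) *\<^sub>R
      - (Poly_Mapping.single a 1 - Poly_Mapping.single c 1)"
    and "vert s h w' = y + slack s h y (prefix_route s (u1 @ [c])) *\<^sub>R
      (Poly_Mapping.single a 1 - Poly_Mapping.single c 1)"
proof -
  obtain B' where B': "B = B' @ [a]" using block_ends by (metis append_butlast_last_id)
  have "vert s (slack s h y) w = slack s h y (prefix_route s ((u1 @ B') @ [a])) *\<^sub>R
      (Poly_Mapping.single c 1 - Poly_Mapping.single a 1)"
  proof (rule vert_single_prefix[OF stir])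
    show "w = (u1 @ B') @ [a] @ [c] @ u2" by (simp add: w_eq B')
    show "slack s h y (prefix_route s p) = 0" if "w = p @ q" "p \<noteq> (u1 @ B') @ [a]" for p q
    proof -
      have "p \<noteq> u1 @ B" using that(2) by (simp add: B')
      from prefix_route_in_exchanged[OF that(1) this] prefix_routesI[OF that(1)]
      show ?thesis by (intro assms(2) IntI)
    qed
  qed
  then show "vert s h w = y + slack s h y (prefix_route s (u1 @ B)) *\<^sub>R
      - (Poly_Mapping.single a 1 - Poly_Mapping.single c 1)"
    unfolding vert_eq_add_vert_slack[OF comp stir assms(1), of h] by (simp add: B')
  obtain B'' where B'': "B = a # B''" using block_ends by (metis list.collapse)
  have "vert s (slack s h y) w' = slack s h y (prefix_route s (u1 @ [c])) *\<^sub>R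
      (Poly_Mapping.single a 1 - Poly_Mapping.single c 1)"
  proof (rule vert_single_prefix[OF stir'])
    show "w' = u1 @ [c] @ [a] @ (B'' @ u2)" by (simp add: w'_eq B'')
    show "slack s h y (prefix_route s p) = 0" if "w' = p @ q" "p \<noteq> u1 @ [c]" for p q
      using prefix_route_in_original[OF that] prefix_routesI[OF that(1)] by (intro assms(2) IntI)
  qed
  then show "vert s h w' = y + slack s h y (prefix_route s (u1 @ [c])) *\<^sub>R
      (Poly_Mapping.single a 1 - Poly_Mapping.single c 1)"
    unfolding vert_eq_add_vert_slack[OF comp stir' assms(1), of h] by simp
qed

text \<open>The other three routes belong to prefixes of \<open>w\<close> and have slack 0 at its
  vertex; \<open>weight_exchange\<close> then eliminates all weights.\<close>

lemma slack_new_route: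
  assumes "admissible s h"
  shows "slack s h (vert s h w) (prefix_route s (u1 @ [c])) =
      h (prefix_route s (u1 @ [c])) + h (prefix_route s (u1 @ B))
        - h (prefix_route s u1) - h (prefix_route s (u1 @ B @ [c]))"
proof -
  have zero: "slack s h (vert s h w) (prefix_route s p) = 0" if "w = p @ q" for p q
    using slack_vert_zero_iff[OF comp assms stir] prefix_routesI[OF that, of s] prefix_routes_subset[OF comp stir]
    by blast
  show ?thesis
    using zero[of u1 "B @ [c] @ u2"] zero[of "u1 @ B" "[c] @ u2"] zero[of "u1 @ B @ [c]" u2]
      weight_exchange[of "point_potential s h (vert s h w)"]
    by (simp add: w_eq slack_def)
qed

lemma vert_diff:
  assumes "admissible s h"
  shows "vert s h w' - vert s h w =
    slack s h (vert s h w) (prefix_route s (u1 @ [c])) *\<^sub>R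
      (Poly_Mapping.single a 1 - Poly_Mapping.single c 1)"
proof -
  have "slack s h (vert s h w) R = 0" if "R \<in> prefix_routes s w \<inter> prefix_routes s w'" for R
    using slack_vert_zero_iff[OF comp assms stir] that prefix_routes_subset[OF comp stir] by blast
  from vert_eq_add_slack(2)[OF vert_in_euclidean this] show ?thesis by (metis add_diff_cancel_left')
qed

text \<open>The factor of \<open>e_a - e_c\<close> is the slack of a route outside the clique of
  \<open>w\<close>, hence nonzero.\<close>

lemma vert_neq:
  assumes "admissible s h"
  shows "vert s h w \<noteq> vert s h w'"
proof
  assume "vert s h w = vert s h w'"
  then have "slack s h (vert s h w) (prefix_route s (u1 @ [c])) *\<^sub>R
      (Poly_Mapping.single a 1 - Poly_Mapping.single c (1::real)) = 0"
    using vert_diff[OF assms] by simp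
  from arg_cong[OF this, of "\<lambda>x. Poly_Mapping.lookup x a"] a_less_c
  have "slack s h (vert s h w) (prefix_route s (u1 @ [c])) = 0"
    by (simp add: lookup_minus lookup_single)
  moreover have "prefix_route s (u1 @ [c]) \<in> routes s"
    by (rule prefix_route_in_routes[OF comp bounded_counts_around(3)])
  ultimately show False using slack_vert_zero_iff[OF comp assms stir] new_route_notin by blast
qed

lemma Perm_edge_vert:
  assumes "admissible s h"
  shows "Perm_edge s h (vert s h w) (vert s h w')"
proof -
  have "closed_segment (vert s h w) (vert s h w') \<in> Perm s h"
  proof (rule segment_in_Perm[OF comp assms stir stir'])
    show "\<exists>\<delta>\<in>exponents k. route s k t \<delta> \<in> prefix_routes s w \<inter> prefix_routes s w'"
      if "(k, t) \<in> hypersurface_indices s" for k t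
      using that common_route_of_type by (auto simp: hypersurface_indices_def)
    fix y assume y: "y \<in> euclidean (length s)"
      "\<And>R. R \<in> prefix_routes s w \<inter> prefix_routes s w' \<Longrightarrow> slack s h y R = 0"
    \<comment> \<open>Seen from \<open>y\<close>, the two vertices are displaced in opposite
      directions by nonnegative slacks.\<close>
    show "y \<in> closed_segment (vert s h w) (vert s h w')"
      by (simp only: vert_eq_add_slack[OF y], intro between_in_closed_segment slack_nonneg[OF comp] prefix_route_in_routes[OF comp]
          bounded_counts_around)
  qed
  then show ?thesis
    using Perm_vertex_vert[OF comp assms] stir stir' vert_neq[OF assms] by (simp add: Perm_edge_def)
qed

end

theorem theorem6p36:
  fixes s :: "nat list" and h :: "edge list \<Rightarrow> real"
    and a c :: nat and w w' u1 u2 B :: "nat list"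
  assumes "composition s"
    and "admissible s h"
    and "1 \<le> a" and "a < c" and "c \<le> length s"
    and "stirling_perm s w" and "stirling_perm s w'"
    and "is_block w a B"
    and "w = u1 @ B @ [c] @ u2"
    and "w' = u1 @ [c] @ B @ u2"
  shows "Perm_edge s h (vert s h w) (vert s h w') \<and>
    vert s h w' - vert s h w =
      (h (prefix_route s (u1 @ [c])) + h (prefix_route s (u1 @ B))
        - h (prefix_route s u1) - h (prefix_route s (u1 @ B @ [c])))
      *\<^sub>R (Poly_Mapping.single a 1 - Poly_Mapping.single c 1)"
proof -
  interpret block_exchange s a c w w' u1 u2 B
    using assms by unfold_locales
  show ?thesis
    using Perm_edge_vert[OF assms(2)] vert_diff[OF assms(2)] slack_new_route[OF assms(2)] by simp
qed

end
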